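(* Let $n=2$, let $\Omega\subset\mathbb R^2$ be open, and let $a:(0,\infty)\to(0,\infty)$ be such that the function $b$ given by $b(t)=t\,a(t)$ for $t>0$, $b(0)=0$, satisfies $b\in C^1([0,\infty))$, and $$-\frac{5}{2(4+\sqrt6)}<i_a\le s_a<\infty.$$ Then there exist positive constants $c_1$ and $c_2$, depending only on $i_a$ and $s_a$, such that for every $u\in C^3(\Omega;\mathbb R^2)$ $$|\mathrm{div}(\mathcal A(\mathcal E u))|^2\ge c_1\,a^2(|\mathcal E u|)\,|\nabla\mathcal E u|^2+c_2\,\mathrm{div}\Big(a^2(|\mathcal E u|)\big((\Delta u)^T\mathcal E u-\tfrac12\nabla(|\mathcal E u|^2)\big)\Big)\quad\text{in }\Omega.$$
   Context: $i_a=\inf_{t>0}\frac{t\,a'(t)}{a(t)}$ and $s_a=\sup_{t>0}\frac{t\,a'(t)}{a(t)}$. The function $a$ is extended continuously to $0$ by $a(0)=b'(0)$. The map $\mathcal A:\mathbb R^{2\times 2}\to\mathbb R^{2\times 2}$ is $\mathcal A(\xi)=a(|\xi|)\xi$ if $\xi\ne0$, $\mathcal A(0)=0$. $\mathcal E u=\tfrac12(\nabla u+(\nabla u)^T)$; $|\cdot|$ is the Euclidean norm of vectors, matrices (Frobenius) and third-order tensors; $a^2(t)=(a(t))^2$. $\Delta u$ is the column vector of componentwise Laplacians; gradients of scalar functions are row vectors; the divergence of a row vector field is the usual one, and the divergence of a matrix field is taken row by row. *)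

theory Defs
  imports "HOL-Analysis.Analysis"
begin

section \<open>Classical differential operators on Euclidean space\<close>

text \<open>
  Everything that is differentiated below is differentiable wherever \<open>u\<close> is three times continuously
  differentiable and \<open>t a(t)\<close> is continuously differentiable up to \<open>0\<close>; so the partial derivative
  may be taken as the value of the Frechet derivative on a coordinate vector.
\<close>

definition partial :: "'n \<Rightarrow> (real ^ 'n \<Rightarrow> real) \<Rightarrow> real ^ 'n \<Rightarrow> real" where
  "partial j f x = frechet_derivative f (at x) (axis j 1)"

definition grad :: "(real ^ 'n \<Rightarrow> real) \<Rightarrow> real ^ 'n \<Rightarrow> real ^ 'n" where
  "grad f x = (\<chi> j. partial j f x)"

definition vec_grad :: "(real ^ 'n \<Rightarrow> real ^ 'm) \<Rightarrow> real ^ 'n \<Rightarrow> real ^ 'n ^ 'm" where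
  "vec_grad u x = (\<chi> i. grad (\<lambda>y. u y $ i) x)"

definition mat_grad :: "(real ^ 'n \<Rightarrow> real ^ 'k ^ 'm) \<Rightarrow> real ^ 'n \<Rightarrow> real ^ 'n ^ 'k ^ 'm" where
  "mat_grad M x = (\<chi> i. vec_grad (\<lambda>y. M y $ i) x)"

definition vec_div :: "(real ^ 'n \<Rightarrow> real ^ 'n) \<Rightarrow> real ^ 'n \<Rightarrow> real" where
  "vec_div v x = (\<Sum>j\<in>UNIV. partial j (\<lambda>y. v y $ j) x)"

definition mat_div :: "(real ^ 'n \<Rightarrow> real ^ 'n ^ 'm) \<Rightarrow> real ^ 'n \<Rightarrow> real ^ 'm" where
  "mat_div M x = (\<chi> i. vec_div (\<lambda>y. M y $ i) x)"

definition laplacian :: "(real ^ 'n \<Rightarrow> real) \<Rightarrow> real ^ 'n \<Rightarrow> real" where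
  "laplacian f x = (\<Sum>j\<in>UNIV. partial j (partial j f) x)"

definition vec_laplacian :: "(real ^ 'n \<Rightarrow> real ^ 'm) \<Rightarrow> real ^ 'n \<Rightarrow> real ^ 'm" where
  "vec_laplacian u x = (\<chi> i. laplacian (\<lambda>y. u y $ i) x)"

definition sym_grad :: "(real ^ 'n \<Rightarrow> real ^ 'n) \<Rightarrow> real ^ 'n \<Rightarrow> real ^ 'n ^ 'n" where
  "sym_grad u x = (1/2) *\<^sub>R (vec_grad u x + transpose (vec_grad u x))"

text \<open>\<open>Ck_on k f S\<close>: \<open>f\<close> is of class $C^k$ on \<open>S\<close>; meant for open \<open>S\<close> only.\<close>

primrec Ck_on ::
  "nat \<Rightarrow> ('a::real_normed_vector \<Rightarrow> 'b::real_normed_vector) \<Rightarrow> 'a set \<Rightarrow> bool" where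
  "Ck_on 0 f S \<longleftrightarrow> continuous_on S f"
| "Ck_on (Suc k) f S \<longleftrightarrow>
     (\<forall>x\<in>S. f differentiable (at x)) \<and>
     (\<forall>v. Ck_on k (\<lambda>x. frechet_derivative f (at x) v) S)"

section \<open>The nonlinearity\<close>

text \<open>
  Only the values of \<open>a\<close> on \<open>(0,\<infinity>)\<close> are meaningful; no definition below looks at any others.
\<close>

definition b_fun :: "(real \<Rightarrow> real) \<Rightarrow> real \<Rightarrow> real" where
  "b_fun a t = (if t > 0 then t * a t else 0)"

text \<open>Class $C^1$ on $[0,\infty)$, with the one-sided derivative at \<open>0\<close>.\<close>

definition C1_halfline :: "(real \<Rightarrow> real) \<Rightarrow> bool" where
  "C1_halfline f \<longleftrightarrow>
     f differentiable_on {0..} \<and>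
     continuous_on {0..} (\<lambda>t. vector_derivative f (at t within {0..}))"

text \<open>The continuous extension of \<open>a\<close> to \<open>0\<close> by \<open>b'(0)\<close>.\<close>

definition a_ext :: "(real \<Rightarrow> real) \<Rightarrow> real \<Rightarrow> real" where
  "a_ext a t = (if t > 0 then a t else vector_derivative (b_fun a) (at 0 within {0..}))"

definition lower_index :: "(real \<Rightarrow> real) \<Rightarrow> ereal" where
  "lower_index a = (INF t\<in>{0<..}. ereal (t * deriv a t / a t))"

definition upper_index :: "(real \<Rightarrow> real) \<Rightarrow> ereal" where
  "upper_index a = (SUP t\<in>{0<..}. ereal (t * deriv a t / a t))"

text \<open>The library norm on nested vectors is the Euclidean one, hence Frobenius on matrices.\<close>

definition stress :: "(real \<Rightarrow> real) \<Rightarrow> real ^ 2 ^ 2 \<Rightarrow> real ^ 2 ^ 2" where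
  "stress a \<xi> = (if \<xi> = 0 then 0 else a (norm \<xi>) *\<^sub>R \<xi>)"

end

theory Submission
  imports Defs
begin

text \<open>
  Where $E = \mathcal E u \ne 0$, put $N = E/|E|$, $w = N : \nabla E$, $\theta = |E| a'(|E|)/a(|E|)$. Then
  $|\mathrm{div}(\mathcal A(E))|^2 = a^2 |\mathrm{div} E + \theta N w|^2$, and since third derivatives of \<open>u\<close>
  commute, the divergence on the right is
  $a^2 (2 \theta w \cdot (N \Delta u - w) + \mathrm{div} E \cdot \Delta u - |\nabla E|^2)$, a quadratic form in
  $\nabla E$. In an orthonormal basis diagonalising $N$ everything splits into two forms in three variables.
  With $m$ the corresponding component of $\mathrm{div} E + \theta N w$, the difference of the two sides for
  $c_1 = 0$, $c_2 = c$ is $m^2 - c m \ell + c G$ with $\ell$ linear and $G$ a binary form in the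
  remaining variables; $G$ is positive definite for $\theta \ge -2/5$, which covers the hypothesis on
  $i_a$ because $\sqrt 6 > 9/4$. So any small $c$ works.
\<close>

section \<open>The quadratic form\<close>

text \<open>The polynomial is four times the determinant of the binary form G in one block;
  \<open>p\<close> and \<open>q\<close> are the eigenvalues of N, and \<open>t\<close> is theta.
  This is where the threshold -2/5 enters.\<close>

lemma discriminant_lower_bound:
  fixes p q t :: real
  assumes pq: "p\<^sup>2 + q\<^sup>2 = 1" and t: "- (2/5) \<le> t"
  shows "4/5 \<le> 12 + t * (24 + 4 * p\<^sup>2 + 12 * p * q) + t\<^sup>2 * p\<^sup>2 * (23 - 8 * p\<^sup>2 + 10 * p * q)"
proof -
  define P where "P = p\<^sup>2"
  define r where "r = p * q"
  have P: "0 \<le> P" "P \<le> 1"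
    using pq zero_le_power2[of q] zero_le_power2[of p] unfolding P_def by linarith+
  have r: "\<bar>r\<bar> \<le> 1/2"
  proof -
    have "0 \<le> (p - q)\<^sup>2" "0 \<le> (p + q)\<^sup>2" by simp_all
    then show ?thesis using pq by (simp add: r_def power2_eq_square algebra_simps)
  qed
  \<comment> \<open>AM-GM weighted at $q/p = 3/2$, close to where the discriminant is smallest\<close>
  have r': "r \<le> 1/3 + 5/12 * P"
  proof -
    have "0 \<le> (3 * p - 2 * q)\<^sup>2" by simp
    then show ?thesis using pq by (simp add: r_def P_def power2_eq_square algebra_simps)
  qed
  have "4/5 \<le> 12 + t * (24 + 4 * P + 12 * r) + t\<^sup>2 * P * (23 - 8 * P + 10 * r)"
  proof (cases "0 \<le> t")
    case True
    have "0 \<le> 24 + 4 * P + 12 * r" "0 \<le> 23 - 8 * P + 10 * r" using P r by auto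
    then have "0 \<le> t * (24 + 4 * P + 12 * r)" "0 \<le> t\<^sup>2 * P * (23 - 8 * P + 10 * r)"
      using True P by simp_all
    then show ?thesis by linarith
  next
    case False
    \<comment> \<open>For negative \<open>t\<close> the expression decreases in \<open>r\<close>, so
      \<open>r\<close> may be replaced by the upper bound \<open>r'\<close>; the result is smallest
      at \<open>s = 2/5\<close>, where it equals \<open>4/5 + 46/75 * (P * (1 - P))\<close>. Both
      losses appear as nonnegative products in the identity below.\<close>
    define s where "s = - t"
    have s: "0 \<le> s" "s \<le> 2/5" using False t by (simp_all add: s_def)
    have sP: "s * P \<le> 2/5 * 1" using s P by (intro mult_mono) auto
    have "0 \<le> 12 - 10 * (s * P)" using sP by linarith
    then have "0 \<le> s * (12 - 10 * (s * P)) * (1/3 + 5/12 * P - r)"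
      using s P r' by (intro mult_nonneg_nonneg) auto
    moreover have "0 \<le> (2/5 - s) * (28 + 9 * P - (s + 2/5) * (P * (79/3 - 23/6 * P)))"
    proof (rule mult_nonneg_nonneg)
      have "P * (79/3 - 23/6 * P) \<le> 1 * (79/3)"
        using P by (intro mult_mono) auto
      then have "(s + 2/5) * (P * (79/3 - 23/6 * P)) \<le> (4/5) * (79/3)"
        using s P by (intro mult_mono) auto
      then show "0 \<le> 28 + 9 * P - (s + 2/5) * (P * (79/3 - 23/6 * P))" using P by linarith
    qed (use s in simp)
    moreover have "0 \<le> P * (1 - P)" using P by simp
    moreover have "12 + t * (24 + 4 * P + 12 * r) + t\<^sup>2 * P * (23 - 8 * P + 10 * r)
        = s * (12 - 10 * (s * P)) * (1/3 + 5/12 * P - r)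
          + (2/5 - s) * (28 + 9 * P - (s + 2/5) * (P * (79/3 - 23/6 * P)))
          + 4/5 + 46/75 * (P * (1 - P))"
      by (simp add: s_def power2_eq_square field_simps)
    ultimately show ?thesis by linarith
  qed
  then show ?thesis by (simp add: P_def r_def mult.assoc)
qed

text \<open>The least eigenvalue of a positive definite 2x2 matrix is at least its determinant
  divided by its trace; here the matrix M has rows (A, H) and (H, B).\<close>

lemma binary_form_lower_bound:
  fixes A B H T d x y :: real
  assumes "d \<le> A * B - H\<^sup>2" "0 < d" "0 < A" "A + B \<le> T"
  shows "d / T * (x\<^sup>2 + y\<^sup>2) \<le> A * x\<^sup>2 + 2 * H * x * y + B * y\<^sup>2"
proof -
  have "0 < A * B" using assms zero_le_power2[of H] by linarith
  then have B: "0 < B" using assms zero_less_mult_pos by blast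
  have "d * (x\<^sup>2 + y\<^sup>2) \<le> (A * B - H\<^sup>2) * (x\<^sup>2 + y\<^sup>2)"
    using assms by (intro mult_right_mono) auto
  \<comment> \<open>The added squares are |M v|^2 for v = (x, y). By Cayley-Hamilton, det M |v|^2 +
    |M v|^2 is the trace of M times the form at v.\<close>
  also have "\<dots> \<le> (A * B - H\<^sup>2) * (x\<^sup>2 + y\<^sup>2) + (A * x + H * y)\<^sup>2 + (H * x + B * y)\<^sup>2"
    by simp
  also have "\<dots> = (A + B) * (A * x\<^sup>2 + 2 * H * x * y + B * y\<^sup>2)"
    by (simp add: power2_eq_square algebra_simps)
  finally have 1: "d * (x\<^sup>2 + y\<^sup>2) \<le> (A + B) * (A * x\<^sup>2 + 2 * H * x * y + B * y\<^sup>2)" .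
  have "0 \<le> d * (x\<^sup>2 + y\<^sup>2)" using assms by simp
  with 1 have "0 \<le> A * x\<^sup>2 + 2 * H * x * y + B * y\<^sup>2"
    using assms B by (smt (verit) mult_pos_neg)
  then have "(A + B) * (A * x\<^sup>2 + 2 * H * x * y + B * y\<^sup>2) \<le> T * (A * x\<^sup>2 + 2 * H * x * y + B * y\<^sup>2)"
    using assms by (intro mult_right_mono) auto
  with 1 have "d * (x\<^sup>2 + y\<^sup>2) \<le> T * (A * x\<^sup>2 + 2 * H * x * y + B * y\<^sup>2)" by linarith
  then show ?thesis using assms B by (simp add: field_simps)
qed

lemma block_form_coercive:
  fixes S :: real
  assumes S: "1 \<le> S"
  shows "\<exists>k>0. \<forall>p q t x y. p\<^sup>2 + q\<^sup>2 = 1 \<longrightarrow> - (2/5) \<le> t \<longrightarrow> t \<le> S \<longrightarrow>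
    k * (x\<^sup>2 + y\<^sup>2) \<le> 3 * x\<^sup>2 + y\<^sup>2 + t * p * (p * x + q * y) * (5 * x + y)
      + 2 * t * (p * x + q * y)\<^sup>2 + 4 * t\<^sup>2 * p\<^sup>2 * (p * x + q * y)\<^sup>2"
proof (intro exI conjI allI impI)
  \<comment> \<open>\<open>T\<close> bounds the trace from above and \<open>1/5\<close> bounds the
    determinant from below, both uniformly in \<open>p\<close>, \<open>q\<close>,
    \<open>t\<close>.\<close>
  define T where "T = 4 + 16 * S + 16 * S\<^sup>2"
  show "0 < (1/5) / T" using S by (simp add: T_def add_pos_nonneg)
  fix p q t x y :: real
  assume pq: "p\<^sup>2 + q\<^sup>2 = 1" and t: "- (2/5) \<le> t" "t \<le> S"
  \<comment> \<open>\<open>A\<close>, \<open>B\<close> and \<open>2 * H\<close> are the coefficients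
    of \<open>x^2\<close>, \<open>y^2\<close> and \<open>x * y\<close>. The factorised
    \<open>A\<close> is visibly positive, since \<open>t * p^2\<close> is at least -2/5.\<close>
  define A where "A = (3 + 4 * t * p\<^sup>2) * (1 + t * p\<^sup>2)"
  define B where "B = 1 + t * (p * q + 2 * q\<^sup>2 + 4 * t * p\<^sup>2 * q\<^sup>2)"
  define H where "H = t * (p\<^sup>2 + 9 * p * q + 8 * t * p ^ 3 * q) / 2"
  have q: "q\<^sup>2 = 1 - p\<^sup>2" using pq by linarith
  have p1: "p\<^sup>2 \<le> 1" "0 \<le> p\<^sup>2" using pq zero_le_power2[of q] zero_le_power2[of p] by linarith+
  have tp: "- (2/5) \<le> t * p\<^sup>2"
  proof -
    have "- (2/5) * 1 \<le> - (2/5) * p\<^sup>2" using p1 by simp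
    also have "\<dots> \<le> t * p\<^sup>2" using t p1 by (intro mult_right_mono) auto
    finally show ?thesis by simp
  qed
  have abst: "\<bar>t\<bar> \<le> S" using t S by auto
  have "4 * (A * B - H\<^sup>2) = 12 + t * (24 + 4 * p\<^sup>2 + 12 * p * q)
      + t\<^sup>2 * p\<^sup>2 * (23 - 8 * p\<^sup>2 + 10 * p * q)"
  proof -
    have H: "H\<^sup>2 = t\<^sup>2 * p\<^sup>2 * (p\<^sup>2 + 2 * p * q * (9 + 8 * t * p\<^sup>2)
        + (9 + 8 * t * p\<^sup>2)\<^sup>2 * q\<^sup>2) / 4"
      by (simp add: H_def power2_eq_square power3_eq_cube algebra_simps)
    show ?thesis
      unfolding H A_def B_def q by (simp add: power2_eq_square field_simps)
  qed
  then have "4/5 \<le> 4 * (A * B - H\<^sup>2)" using discriminant_lower_bound[OF pq t(1)] by (simp only:)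
  moreover have "1/5 \<le> e" if "4/5 \<le> 4 * e" for e :: real using that by linarith
  ultimately have "1/5 \<le> A * B - H\<^sup>2" by blast
  moreover have "0 < A" unfolding A_def using tp by (intro mult_pos_pos) auto
  moreover have "A + B \<le> T"
  proof -
    have r: "\<bar>p * q\<bar> \<le> 1"
    proof -
      have "0 \<le> (p - q)\<^sup>2" "0 \<le> (p + q)\<^sup>2" by simp_all
      then show ?thesis using pq by (simp add: power2_eq_square algebra_simps)
    qed
    have "A + B = 4 + t * (7 * p\<^sup>2 + p * q + 2 * q\<^sup>2) + 4 * t\<^sup>2 * p\<^sup>2"
      unfolding A_def B_def q by (simp add: power2_eq_square algebra_simps)
    moreover have "t * (7 * p\<^sup>2 + p * q + 2 * q\<^sup>2) \<le> \<bar>t\<bar> * \<bar>7 * p\<^sup>2 + p * q + 2 * q\<^sup>2\<bar>"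
      by (metis abs_ge_self abs_mult)
    moreover have "\<dots> \<le> S * 16"
      using abst r p1 q by (intro mult_mono) auto
    moreover have "4 * t\<^sup>2 * p\<^sup>2 \<le> 4 * S\<^sup>2 * 1"
      using abst p1 S abs_le_square_iff[of t S] by (intro mult_mono) auto
    ultimately show ?thesis unfolding T_def using zero_le_power2[of S] by linarith
  qed
  ultimately have "(1/5) / T * (x\<^sup>2 + y\<^sup>2) \<le> A * x\<^sup>2 + 2 * H * x * y + B * y\<^sup>2"
    by (intro binary_form_lower_bound) auto
  also have "\<dots> = 3 * x\<^sup>2 + y\<^sup>2 + t * p * (p * x + q * y) * (5 * x + y)
      + 2 * t * (p * x + q * y)\<^sup>2 + 4 * t\<^sup>2 * p\<^sup>2 * (p * x + q * y)\<^sup>2"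
    by (simp add: A_def B_def H_def power2_eq_square power3_eq_cube algebra_simps)
  finally show "(1/5) / T * (x\<^sup>2 + y\<^sup>2) \<le> 3 * x\<^sup>2 + y\<^sup>2
      + t * p * (p * x + q * y) * (5 * x + y)
      + 2 * t * (p * x + q * y)\<^sup>2 + 4 * t\<^sup>2 * p\<^sup>2 * (p * x + q * y)\<^sup>2" .
qed

text \<open>\<open>x\<close>, \<open>y\<close>, \<open>z\<close> are the entries of grad E in one
  block; \<open>w\<close> and \<open>L\<close> are the matching components of N : grad E and of the
  Laplacian of u. Young's inequality absorbs the cross term \<open>c * (m * l)\<close> into half of
  \<open>m^2\<close> and half of the lower bound of \<open>c * G\<close>; the other halves control
  all three squares.\<close>

lemma block_inequality:
  fixes S :: real
  assumes S: "1 \<le> S"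
  shows "\<exists>c1>0. \<exists>c2>0. \<forall>p q t x y z w L. p\<^sup>2 + q\<^sup>2 = 1 \<longrightarrow> - (2/5) \<le> t \<longrightarrow> t \<le> S \<longrightarrow>
    w = p * x + q * y \<longrightarrow> L = x + 2 * z - y \<longrightarrow>
    c1 * (x\<^sup>2 + y\<^sup>2 + 2 * z\<^sup>2)
      + c2 * (2 * t * w * (p * L - w) + (x + z) * L - (x\<^sup>2 + y\<^sup>2 + 2 * z\<^sup>2))
    \<le> (x + z + t * p * w)\<^sup>2"
proof -
  obtain k where k: "0 < k" and coercive: "\<And>p q t x y. p\<^sup>2 + q\<^sup>2 = 1 \<Longrightarrow> - (2/5) \<le> t \<Longrightarrow> t \<le> S \<Longrightarrow>
    k * (x\<^sup>2 + y\<^sup>2) \<le> 3 * x\<^sup>2 + y\<^sup>2 + t * p * (p * x + q * y) * (5 * x + y)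
      + 2 * t * (p * x + q * y)\<^sup>2 + 4 * t\<^sup>2 * p\<^sup>2 * (p * x + q * y)\<^sup>2"
    using block_form_coercive[OF S] by blast
  \<comment> \<open>\<open>K\<close> serves in \<open>l^2 <= K * n\<close>, and
    \<open>c = k / K\<close> makes the Young remainder exactly half of \<open>c * k * n\<close>.
    \<open>M\<close> comes from estimating \<open>z\<close> through \<open>m\<close>, and
    \<open>d\<close> is small enough for the two remaining halves to absorb that estimate.\<close>
  define K where "K = 30 + 48 * S\<^sup>2"
  define c where "c = k / K"
  define M where "M = 7 + 6 * S\<^sup>2"
  define d where "d = min (1 / 12) (c * k / (2 * M))"
  have pos: "0 < K" "0 < M" "0 < c"
    using k by (simp_all add: K_def M_def c_def add_pos_nonneg)
  have d: "0 < d" "d \<le> 1/12" "d * M \<le> c * k / 2"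
    using pos k by (auto simp: d_def min_def field_simps)
  show ?thesis
  proof (rule exI[of _ d], rule conjI[OF d(1)], rule exI[of _ c], rule conjI[OF pos(3)], intro allI impI)
    fix p q t x y z w L :: real
    assume pq: "p\<^sup>2 + q\<^sup>2 = 1" and t: "- (2/5) \<le> t" "t \<le> S"
      and w: "w = p * x + q * y" and L: "L = x + 2 * z - y"
    define m where "m = x + z + t * p * w"
    define l where "l = 3 * x - y + 4 * (t * p * w)"
    define G where "G = 3 * x\<^sup>2 + y\<^sup>2 + t * p * w * (5 * x + y) + 2 * t * w\<^sup>2 + 4 * t\<^sup>2 * p\<^sup>2 * w\<^sup>2"
    define n where "n = x\<^sup>2 + y\<^sup>2"
    have n: "x\<^sup>2 \<le> n" "0 \<le> n" by (simp_all add: n_def)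
    have G: "k * n \<le> G" using coercive[OF pq t, of x y] by (simp add: G_def w n_def)
    have "(t * p * w)\<^sup>2 \<le> S\<^sup>2 * n"
    proof -
      \<comment> \<open>Lagrange's identity, which gives Cauchy-Schwarz for
        \<open>w\<close>.\<close>
      have "w\<^sup>2 + (p * y - q * x)\<^sup>2 = (p\<^sup>2 + q\<^sup>2) * n"
        by (simp add: w n_def power2_eq_square algebra_simps)
      then have "w\<^sup>2 + (p * y - q * x)\<^sup>2 = n" by (simp add: pq)
      then have "w\<^sup>2 \<le> n" using zero_le_power2[of "p * y - q * x"] by linarith
      moreover have "p\<^sup>2 \<le> 1" using pq zero_le_power2[of q] by linarith
      moreover have "t\<^sup>2 \<le> S\<^sup>2" using t S by (auto simp: abs_le_square_iff[symmetric])
      ultimately have "(t\<^sup>2 * p\<^sup>2) * w\<^sup>2 \<le> (S\<^sup>2 * 1) * n" by (intro mult_mono) auto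
      then show ?thesis by (simp add: power_mult_distrib)
    qed
    note tpw = this
    have sq3: "(a + b + e)\<^sup>2 \<le> 3 * (a\<^sup>2 + b\<^sup>2 + e\<^sup>2)" for a b e :: real
      using zero_le_power2[of "a - b"] zero_le_power2[of "a - e"] zero_le_power2[of "b - e"]
      by (simp add: power2_eq_square algebra_simps)
    have "l\<^sup>2 \<le> 3 * ((3 * x)\<^sup>2 + (- y)\<^sup>2 + (4 * (t * p * w))\<^sup>2)"
      unfolding l_def using sq3[of "3 * x" "- y" "4 * (t * p * w)"] by simp
    also have "\<dots> = 27 * x\<^sup>2 + 3 * y\<^sup>2 + 48 * (t * p * w)\<^sup>2"
      by (simp only: power_mult_distrib power2_minus) simp
    also have "\<dots> \<le> 30 * n + 48 * (S\<^sup>2 * n)"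
    proof -
      have "27 * x\<^sup>2 + 3 * y\<^sup>2 \<le> 30 * n" by (simp add: n_def)
      then show ?thesis using tpw by linarith
    qed
    also have "\<dots> = K * n" by (simp add: K_def algebra_simps)
    finally have l: "l\<^sup>2 \<le> K * n" .
    have "z\<^sup>2 \<le> 3 * (m\<^sup>2 + (- (t * p * w))\<^sup>2 + (- x)\<^sup>2)"
      using sq3[of m "- (t * p * w)" "- x"] by (simp add: m_def)
    then have z: "n + 2 * z\<^sup>2 \<le> 6 * m\<^sup>2 + M * n"
      using tpw n by (simp add: M_def algebra_simps)
    have "d * (n + 2 * z\<^sup>2) \<le> d * (6 * m\<^sup>2 + M * n)"
      using z d by (intro mult_left_mono) auto
    also have "\<dots> = 6 * d * m\<^sup>2 + d * M * n" by (simp add: algebra_simps)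
    also have "\<dots> \<le> 1/2 * m\<^sup>2 + c * k / 2 * n"
      using d n by (intro add_mono mult_right_mono) auto
    finally have 1: "d * (n + 2 * z\<^sup>2) \<le> 1/2 * m\<^sup>2 + c * k / 2 * n" .
    have "c * (m * l) \<le> 1/2 * m\<^sup>2 + 1/2 * (c\<^sup>2 * l\<^sup>2)"
      using zero_le_power2[of "m - c * l"] by (simp add: power2_eq_square algebra_simps)
    moreover have "c\<^sup>2 * l\<^sup>2 \<le> c\<^sup>2 * (K * n)" using l by (intro mult_left_mono) auto
    moreover have "c\<^sup>2 * (K * n) = c * k * n"
      using pos by (simp add: c_def power2_eq_square)
    moreover have "c * (k * n) \<le> c * G" using G pos by (intro mult_left_mono) auto
    moreover have "c * k / 2 * n = 1/2 * (c * k * n)" "c * (k * n) = c * k * n" by simp_all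
    ultimately have "1/2 * m\<^sup>2 + c * k / 2 * n \<le> m\<^sup>2 - c * (m * l) + c * G" by linarith
    with 1 have "d * (n + 2 * z\<^sup>2) \<le> m\<^sup>2 - c * (m * l) + c * G" by linarith
    \<comment> \<open>With \<open>z = m - x - t * p * w\<close> the \<open>m^2\<close> terms of the
      divergence form cancel, and \<open>m * l - G\<close> remains.\<close>
    moreover have "m\<^sup>2 - c * (m * l) + c * G = (x + z + t * p * w)\<^sup>2
        - c * (2 * t * w * (p * L - w) + (x + z) * L - (x\<^sup>2 + y\<^sup>2 + 2 * z\<^sup>2))"
      unfolding m_def l_def G_def L by (simp add: power2_eq_square algebra_simps)
    ultimately show "d * (x\<^sup>2 + y\<^sup>2 + 2 * z\<^sup>2)
      + c * (2 * t * w * (p * L - w) + (x + z) * L - (x\<^sup>2 + y\<^sup>2 + 2 * z\<^sup>2))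
      \<le> (x + z + t * p * w)\<^sup>2" by (simp add: n_def)
  qed
qed

section \<open>Diagonalisation of N and splitting into two blocks\<close>

text \<open>Rotating the basis turns the complex number with real part \<open>n11 - n22\<close> and
  imaginary part \<open>2 * n12\<close> by twice the angle, so half its argument gives an
  eigenvector.\<close>

lemma symmetric_diagonalisation:
  fixes n11 n12 n22 :: real
  obtains p q c s where "c\<^sup>2 + s\<^sup>2 = 1" "n11 = p * c\<^sup>2 + q * s\<^sup>2" "n12 = (p - q) * c * s"
    "n22 = p * s\<^sup>2 + q * c\<^sup>2"
proof -
  obtain f where "Complex (n11 - n22) (2 * n12) = rcis (cmod (Complex (n11 - n22) (2 * n12))) f"
    by (metis rcis_cmod_Arg)
  then obtain r where 1: "n11 - n22 = r * cos f" "2 * n12 = r * sin f"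
    by (metis complex.sel Re_rcis Im_rcis)
  define c s where "c = cos (f / 2)" and "s = sin (f / 2)"
  have cs: "c\<^sup>2 + s\<^sup>2 = 1" by (simp add: c_def s_def)
  have 2: "cos f = c\<^sup>2 - s\<^sup>2" "sin f = 2 * s * c"
    using cos_double[of "f / 2"] sin_double[of "f / 2"] by (simp_all add: c_def s_def)
  show thesis
  proof (rule that[of c s "(n11 + n22 + r) / 2" "(n11 + n22 - r) / 2"])
    have "(n11 + n22 + r) / 2 * c\<^sup>2 + (n11 + n22 - r) / 2 * s\<^sup>2
        = ((n11 + n22) * (c\<^sup>2 + s\<^sup>2) + r * (c\<^sup>2 - s\<^sup>2)) / 2"
      by (simp add: field_simps)
    then show "n11 = (n11 + n22 + r) / 2 * c\<^sup>2 + (n11 + n22 - r) / 2 * s\<^sup>2"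
      using 1 2 cs by simp
    have "(n11 + n22 + r) / 2 * s\<^sup>2 + (n11 + n22 - r) / 2 * c\<^sup>2
        = ((n11 + n22) * (c\<^sup>2 + s\<^sup>2) - r * (c\<^sup>2 - s\<^sup>2)) / 2"
      by (simp add: field_simps)
    then show "n22 = (n11 + n22 + r) / 2 * s\<^sup>2 + (n11 + n22 - r) / 2 * c\<^sup>2"
      using 1 2 cs by simp
    show "n12 = ((n11 + n22 + r) / 2 - (n11 + n22 - r) / 2) * c * s"
      using 1 2 by (simp add: field_simps)
  qed (rule cs)
qed


lemma rotation_isometry:
  fixes c s :: real
  assumes "c\<^sup>2 + s\<^sup>2 = 1"
  shows "(c * a + s * b)\<^sup>2 + (c * b - s * a)\<^sup>2 = a\<^sup>2 + b\<^sup>2"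
    and "(c * a - s * b)\<^sup>2 + (s * a + c * b)\<^sup>2 = a\<^sup>2 + b\<^sup>2"
    and "(c * a + s * b) * (c * a' + s * b') + (c * b - s * a) * (c * b' - s * a') = a * a' + b * b'"
proof -
  have "(c * a + s * b)\<^sup>2 + (c * b - s * a)\<^sup>2 = (c\<^sup>2 + s\<^sup>2) * (a\<^sup>2 + b\<^sup>2)"
    "(c * a - s * b)\<^sup>2 + (s * a + c * b)\<^sup>2 = (c\<^sup>2 + s\<^sup>2) * (a\<^sup>2 + b\<^sup>2)"
    "(c * a + s * b) * (c * a' + s * b') + (c * b - s * a) * (c * b' - s * a')
      = (c\<^sup>2 + s\<^sup>2) * (a * a' + b * b')"
    by (simp_all add: power2_eq_square algebra_simps)
  then show "(c * a + s * b)\<^sup>2 + (c * b - s * a)\<^sup>2 = a\<^sup>2 + b\<^sup>2"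
    "(c * a - s * b)\<^sup>2 + (s * a + c * b)\<^sup>2 = a\<^sup>2 + b\<^sup>2"
    "(c * a + s * b) * (c * a' + s * b') + (c * b - s * a) * (c * b' - s * a') = a * a' + b * b'"
    by (simp_all add: assms)
qed

text \<open>The pairs \<open>x1 x2\<close>, \<open>y1 y2\<close>, \<open>z1 z2\<close> stand for the
  gradients of E11, E22, E12; \<open>w1 w2\<close> for N : grad E, \<open>L1 L2\<close> for the
  Laplacian of u, \<open>t\<close> for theta. In an eigenbasis of N the inequality is the sum of two
  instances of \<open>block_inequality\<close>, one for \<open>X1, Y1, Z2\<close> and one for
  \<open>Y2, X2, Z1\<close> with the eigenvalues exchanged.\<close>

lemma pointwise_inequality:
  fixes S :: real
  assumes S: "1 \<le> S"
  shows "\<exists>k1>0. \<exists>k2>0. \<forall>t n11 n12 n22 x1 x2 y1 y2 z1 z2 w1 w2 L1 L2.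
    - (2/5) \<le> t \<longrightarrow> t \<le> S \<longrightarrow> n11\<^sup>2 + 2 * n12\<^sup>2 + n22\<^sup>2 = 1 \<longrightarrow>
    w1 = n11 * x1 + 2 * n12 * z1 + n22 * y1 \<longrightarrow> w2 = n11 * x2 + 2 * n12 * z2 + n22 * y2 \<longrightarrow>
    L1 = x1 + 2 * z2 - y1 \<longrightarrow> L2 = y2 + 2 * z1 - x2 \<longrightarrow>
    k1 * (x1\<^sup>2 + x2\<^sup>2 + y1\<^sup>2 + y2\<^sup>2 + 2 * z1\<^sup>2 + 2 * z2\<^sup>2)
      + k2 * (2 * t * (w1 * (n11 * L1 + n12 * L2 - w1) + w2 * (n12 * L1 + n22 * L2 - w2))
         + ((x1 + z2) * L1 + (z1 + y2) * L2)
         - (x1\<^sup>2 + x2\<^sup>2 + y1\<^sup>2 + y2\<^sup>2 + 2 * z1\<^sup>2 + 2 * z2\<^sup>2))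
    \<le> (x1 + z2 + t * (n11 * w1 + n12 * w2))\<^sup>2 + (z1 + y2 + t * (n12 * w1 + n22 * w2))\<^sup>2"
proof -
  obtain k1 k2 where k: "0 < k1" "0 < k2" and block:
    "\<And>p q t x y z w L. p\<^sup>2 + q\<^sup>2 = 1 \<Longrightarrow> - (2/5) \<le> t \<Longrightarrow> t \<le> S \<Longrightarrow>
      w = p * x + q * y \<Longrightarrow> L = x + 2 * z - y \<Longrightarrow>
      k1 * (x\<^sup>2 + y\<^sup>2 + 2 * z\<^sup>2)
        + k2 * (2 * t * w * (p * L - w) + (x + z) * L - (x\<^sup>2 + y\<^sup>2 + 2 * z\<^sup>2))
      \<le> (x + z + t * p * w)\<^sup>2"
    using block_inequality[OF S] by blast
  show ?thesis
  proof (rule exI[of _ k1], rule conjI[OF k(1)], rule exI[of _ k2], rule conjI[OF k(2)],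
      intro allI impI)
    fix t n11 n12 n22 x1 x2 y1 y2 z1 z2 w1 w2 L1 L2 :: real
    assume t: "- (2/5) \<le> t" "t \<le> S" and unit: "n11\<^sup>2 + 2 * n12\<^sup>2 + n22\<^sup>2 = 1"
      and w: "w1 = n11 * x1 + 2 * n12 * z1 + n22 * y1" "w2 = n11 * x2 + 2 * n12 * z2 + n22 * y2"
      and L: "L1 = x1 + 2 * z2 - y1" "L2 = y2 + 2 * z1 - x2"
    obtain p q c s where cs: "c\<^sup>2 + s\<^sup>2 = 1"
      and n: "n11 = p * c\<^sup>2 + q * s\<^sup>2" "n12 = (p - q) * c * s" "n22 = p * s\<^sup>2 + q * c\<^sup>2"
      by (rule symmetric_diagonalisation)
    note iso = rotation_isometry[OF cs]
    have "n11\<^sup>2 + 2 * n12\<^sup>2 + n22\<^sup>2 = (p\<^sup>2 + q\<^sup>2) * (c\<^sup>2 + s\<^sup>2)\<^sup>2"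
      unfolding n by (simp add: power2_eq_square algebra_simps)
    then have pq: "p\<^sup>2 + q\<^sup>2 = 1" using unit by (simp add: cs)
    have qp: "q\<^sup>2 + p\<^sup>2 = 1" using pq by linarith
    \<comment> \<open>\<open>X\<close>, \<open>Y\<close>, \<open>Z\<close> are the 11, 22 and 12
      entries, in the eigenbasis (c, s), (-s, c), of the symmetric matrix with entries
      \<open>x\<close>, \<open>y\<close>, \<open>z\<close>.\<close>
    define X where "X x y z = c\<^sup>2 * x + 2 * (c * s) * z + s\<^sup>2 * y" for x y z :: real
    define Y where "Y x y z = s\<^sup>2 * x - 2 * (c * s) * z + c\<^sup>2 * y" for x y z :: real
    define Z where "Z x y z = c * s * (y - x) + (c\<^sup>2 - s\<^sup>2) * z" for x y z :: real
    have conj_norm: "(X x y z)\<^sup>2 + (Y x y z)\<^sup>2 + 2 * (Z x y z)\<^sup>2 = x\<^sup>2 + y\<^sup>2 + 2 * z\<^sup>2" for x y z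
    proof -
      have "(X x y z)\<^sup>2 + (Y x y z)\<^sup>2 + 2 * (Z x y z)\<^sup>2
          = (c\<^sup>2 + s\<^sup>2)\<^sup>2 * (x\<^sup>2 + y\<^sup>2 + 2 * z\<^sup>2)"
        unfolding X_def Y_def Z_def by (simp add: power2_eq_square algebra_simps)
      then show ?thesis by (simp add: cs)
    qed
    have conj_inner: "n11 * x + 2 * n12 * z + n22 * y = p * X x y z + q * Y x y z" for x y z
      unfolding n X_def Y_def by (simp add: algebra_simps)
    \<comment> \<open>The index of differentiation is rotated as well: 1 now means the direction (c,
      s) and 2 the direction (-s, c).\<close>
    define X1 X2 where "X1 = c * X x1 y1 z1 + s * X x2 y2 z2" and "X2 = c * X x2 y2 z2 - s * X x1 y1 z1"
    define Y1 Y2 where "Y1 = c * Y x1 y1 z1 + s * Y x2 y2 z2" and "Y2 = c * Y x2 y2 z2 - s * Y x1 y1 z1"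
    define Z1 Z2 where "Z1 = c * Z x1 y1 z1 + s * Z x2 y2 z2" and "Z2 = c * Z x2 y2 z2 - s * Z x1 y1 z1"
    define W1 W2 where "W1 = c * w1 + s * w2" and "W2 = c * w2 - s * w1"
    define D1 D2 where "D1 = c * (x1 + z2) + s * (z1 + y2)" and "D2 = c * (z1 + y2) - s * (x1 + z2)"
    define M1 M2 where "M1 = c * L1 + s * L2" and "M2 = c * L2 - s * L1"
    have "X1\<^sup>2 + X2\<^sup>2 = (X x1 y1 z1)\<^sup>2 + (X x2 y2 z2)\<^sup>2" "Y1\<^sup>2 + Y2\<^sup>2 = (Y x1 y1 z1)\<^sup>2 + (Y x2 y2 z2)\<^sup>2"
      "Z1\<^sup>2 + Z2\<^sup>2 = (Z x1 y1 z1)\<^sup>2 + (Z x2 y2 z2)\<^sup>2"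
      unfolding X1_def X2_def Y1_def Y2_def Z1_def Z2_def by (rule iso)+
    then have nsq: "x1\<^sup>2 + x2\<^sup>2 + y1\<^sup>2 + y2\<^sup>2 + 2 * z1\<^sup>2 + 2 * z2\<^sup>2
        = (X1\<^sup>2 + Y1\<^sup>2 + 2 * Z2\<^sup>2) + (Y2\<^sup>2 + X2\<^sup>2 + 2 * Z1\<^sup>2)"
      using conj_norm[of x1 y1 z1] conj_norm[of x2 y2 z2] by linarith
    have W: "W1 = p * X1 + q * Y1" "W2 = q * Y2 + p * X2"
      unfolding W1_def W2_def w conj_inner X1_def X2_def Y1_def Y2_def by (simp_all add: algebra_simps)
    have "X1 + Z2 = (c\<^sup>2 + s\<^sup>2) * D1" "Z1 + Y2 = (c\<^sup>2 + s\<^sup>2) * D2"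
      unfolding X1_def Z2_def Z1_def Y2_def X_def Y_def Z_def D1_def D2_def
      by (simp_all add: power2_eq_square algebra_simps)
    then have D: "X1 + Z2 = D1" "Y2 + Z1 = D2" by (simp_all add: cs add.commute)
    have "X1 + 2 * Z2 - Y1 = (c\<^sup>2 + s\<^sup>2) * M1" "Y2 + 2 * Z1 - X2 = (c\<^sup>2 + s\<^sup>2) * M2"
      unfolding X1_def Z2_def Z1_def Y2_def X2_def Y1_def X_def Y_def Z_def M1_def M2_def L
      by (simp_all add: power2_eq_square algebra_simps)
    then have M: "M1 = X1 + 2 * Z2 - Y1" "M2 = Y2 + 2 * Z1 - X2" by (simp_all add: cs)
    \<comment> \<open>N acts by rotating into the eigenbasis, scaling by \<open>p\<close> and
      \<open>q\<close>, and rotating back.\<close>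
    have Nv: "n11 * a + n12 * b = c * (p * (c * a + s * b)) - s * (q * (c * b - s * a))"
      "n12 * a + n22 * b = s * (p * (c * a + s * b)) + c * (q * (c * b - s * a))" for a b
      unfolding n by (simp_all add: power2_eq_square algebra_simps)
    have unrotate: "a = c * (c * a + s * b) - s * (c * b - s * a)"
      "b = s * (c * a + s * b) + c * (c * b - s * a)" for a b
    proof -
      have "c * (c * a + s * b) - s * (c * b - s * a) = (c\<^sup>2 + s\<^sup>2) * a"
        "s * (c * a + s * b) + c * (c * b - s * a) = (c\<^sup>2 + s\<^sup>2) * b"
        by (simp_all add: power2_eq_square algebra_simps)
      then show "a = c * (c * a + s * b) - s * (c * b - s * a)"
        "b = s * (c * a + s * b) + c * (c * b - s * a)" by (simp_all add: cs)
    qed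
    have d: "x1 + z2 = c * D1 - s * D2" "z1 + y2 = s * D1 + c * D2"
      unfolding D1_def D2_def by (rule unrotate)+
    have "x1 + z2 + t * (n11 * w1 + n12 * w2) = c * (D1 + t * p * W1) - s * (D2 + t * q * W2)"
      "z1 + y2 + t * (n12 * w1 + n22 * w2) = s * (D1 + t * p * W1) + c * (D2 + t * q * W2)"
      unfolding Nv d W1_def[symmetric] W2_def[symmetric] by (simp_all add: algebra_simps)
    then have lhs: "(x1 + z2 + t * (n11 * w1 + n12 * w2))\<^sup>2 + (z1 + y2 + t * (n12 * w1 + n22 * w2))\<^sup>2
        = (D1 + t * p * W1)\<^sup>2 + (D2 + t * q * W2)\<^sup>2"
      by (simp only: iso)
    have dL: "(x1 + z2) * L1 + (z1 + y2) * L2 = D1 * M1 + D2 * M2"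
      unfolding D1_def D2_def M1_def M2_def by (rule iso(3)[symmetric])
    have ww: "w1\<^sup>2 + w2\<^sup>2 = W1\<^sup>2 + W2\<^sup>2"
      unfolding W1_def W2_def by (rule iso(1)[symmetric])
    have "w1 * (n11 * L1 + n12 * L2) + w2 * (n12 * L1 + n22 * L2) = W1 * (p * M1) + W2 * (q * M2)"
      unfolding Nv M1_def[symmetric] M2_def[symmetric] unfolding W1_def W2_def
      by (simp add: algebra_simps)
    then have wNL: "w1 * (n11 * L1 + n12 * L2 - w1) + w2 * (n12 * L1 + n22 * L2 - w2)
        = W1 * (p * M1 - W1) + W2 * (q * M2 - W2)"
      using ww by (simp add: power2_eq_square algebra_simps)
    show "k1 * (x1\<^sup>2 + x2\<^sup>2 + y1\<^sup>2 + y2\<^sup>2 + 2 * z1\<^sup>2 + 2 * z2\<^sup>2)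
      + k2 * (2 * t * (w1 * (n11 * L1 + n12 * L2 - w1) + w2 * (n12 * L1 + n22 * L2 - w2))
         + ((x1 + z2) * L1 + (z1 + y2) * L2)
         - (x1\<^sup>2 + x2\<^sup>2 + y1\<^sup>2 + y2\<^sup>2 + 2 * z1\<^sup>2 + 2 * z2\<^sup>2))
      \<le> (x1 + z2 + t * (n11 * w1 + n12 * w2))\<^sup>2 + (z1 + y2 + t * (n12 * w1 + n22 * w2))\<^sup>2"
      using add_mono[OF block[OF pq t W(1) M(1)] block[OF qp t W(2) M(2)]]
      unfolding lhs dL wNL nsq D by (simp add: algebra_simps)
  qed
qed

section \<open>Symmetry of second derivatives\<close>

lemma frechet_derivative_cong_open:
  assumes "open S" "x \<in> S" "\<And>y. y \<in> S \<Longrightarrow> f y = g y"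
  shows "frechet_derivative f (at x) = frechet_derivative g (at x)"
proof -
  have "(f has_derivative f') (at x) \<longleftrightarrow> (g has_derivative f') (at x)" for f'
    using has_derivative_transform_within_open[of f f' x UNIV S g]
      has_derivative_transform_within_open[of g f' x UNIV S f] assms by auto
  then show ?thesis unfolding frechet_derivative_def by presburger
qed

lemma differentiable_cong_open:
  assumes "f differentiable (at x)" "open S" "x \<in> S" "\<And>y. y \<in> S \<Longrightarrow> f y = g y"
  shows "g differentiable (at x)"
  using assms has_derivative_transform_within_open[of f _ x UNIV S g]
  unfolding differentiable_def by blast

lemma Ck_on_cong:
  assumes "Ck_on k f S" "open S" "\<And>y. y \<in> S \<Longrightarrow> f y = g y"
  shows "Ck_on k g S"
  using assms
proof (induction k arbitrary: f g)
  case 0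
  then show ?case using continuous_on_cong[of S S f g] by simp
next
  case (Suc k)
  have "g differentiable (at x)" if "x \<in> S" for x
    using differentiable_cong_open[of f x S g] Suc.prems that by auto
  moreover have "Ck_on k (\<lambda>x. frechet_derivative g (at x) v) S" for v
  proof (rule Suc.IH[OF _ Suc.prems(2)])
    show "Ck_on k (\<lambda>x. frechet_derivative f (at x) v) S" using Suc.prems(1) by simp
    show "frechet_derivative f (at y) v = frechet_derivative g (at y) v" if "y \<in> S" for y
      using frechet_derivative_cong_open[OF Suc.prems(2) that Suc.prems(3)] by simp
  qed
  ultimately show ?case by simp
qed

lemma has_derivative_component:
  fixes f :: "'a::real_normed_vector \<Rightarrow> real ^ 'm"
  assumes "(f has_derivative f') F"
  shows "((\<lambda>x. f x $ i) has_derivative (\<lambda>h. f' h $ i)) F"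
  using assms by (rule bounded_linear.has_derivative[OF bounded_linear_vec_nth])

text \<open>A coordinate projection is bounded and linear, so it commutes with every
  differentiation.\<close>

lemma Ck_on_component:
  fixes f :: "'a::real_normed_vector \<Rightarrow> real ^ 'm"
  assumes "Ck_on k f S" "open S"
  shows "Ck_on k (\<lambda>x. f x $ i) S"
  using assms(1)
proof (induction k arbitrary: f)
  case 0
  then show ?case by (auto intro!: continuous_intros)
next
  case (Suc k)
  have der: "((\<lambda>x. f x $ i) has_derivative (\<lambda>h. frechet_derivative f (at x) h $ i)) (at x)"
    if "x \<in> S" for x
    using Suc.prems that by (intro has_derivative_component) (simp add: frechet_derivative_works)
  have "Ck_on k (\<lambda>x. frechet_derivative (\<lambda>x. f x $ i) (at x) v) S" for v
  proof (rule Ck_on_cong[OF _ assms(2)])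
    show "Ck_on k (\<lambda>x. frechet_derivative f (at x) v $ i) S"
      using Suc.prems by (intro Suc.IH) simp
    show "frechet_derivative f (at y) v $ i = frechet_derivative (\<lambda>x. f x $ i) (at y) v"
      if "y \<in> S" for y
      using fun_cong[OF frechet_derivative_at[OF der[OF that]]] by simp
  qed
  then show ?case using der by (auto simp: differentiable_def)
qed

lemma Ck_on_Suc_continuous_on: "Ck_on (Suc k) f S \<Longrightarrow> continuous_on S f"
  by (auto intro!: continuous_at_imp_continuous_on differentiable_imp_continuous_within)

lemma has_real_derivative_along_line:
  fixes f :: "'a::real_normed_vector \<Rightarrow> real"
  assumes "f differentiable (at (a + s *\<^sub>R v))"
  shows "((\<lambda>s. f (a + s *\<^sub>R v)) has_real_derivative frechet_derivative f (at (a + s *\<^sub>R v)) v) (at s)"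
proof -
  let ?f' = "frechet_derivative f (at (a + s *\<^sub>R v))"
  have f': "(f has_derivative ?f') (at (a + s *\<^sub>R v))"
    using assms by (simp add: frechet_derivative_works)
  have "((\<lambda>s. a + s *\<^sub>R v) has_derivative (\<lambda>h. h *\<^sub>R v)) (at s)"
    by (auto intro!: derivative_eq_intros)
  from has_derivative_compose[OF this f']
  have "((\<lambda>s. f (a + s *\<^sub>R v)) has_derivative (\<lambda>h. ?f' (h *\<^sub>R v))) (at s)" .
  moreover have "(\<lambda>h. ?f' (h *\<^sub>R v)) = (*) (?f' v)"
    using linear_frechet_derivative[OF assms] by (auto simp: linear_scale)
  ultimately show ?thesis by (simp add: has_field_derivative_def)
qed

section \<open>Equality of mixed second derivatives\<close>

text \<open>The mean value theorem is applied twice to the second difference over a parallelogram,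
  first along \<open>v\<close> and then along \<open>w\<close>.\<close>

lemma second_difference_mean_value:
  fixes f :: "'a::real_normed_vector \<Rightarrow> real"
  assumes S: "ball x e \<subseteq> S"
    and diff: "\<And>y. y \<in> S \<Longrightarrow> f differentiable (at y)"
      "\<And>y. y \<in> S \<Longrightarrow> (\<lambda>y. frechet_derivative f (at y) v) differentiable (at y)"
    and h: "0 < h" "h * (norm v + norm w) < e"
  obtains y where "dist x y \<le> h * (norm v + norm w)"
    "f (x + h *\<^sub>R v + h *\<^sub>R w) - f (x + h *\<^sub>R v) - f (x + h *\<^sub>R w) + f x
      = h\<^sup>2 * frechet_derivative (\<lambda>y. frechet_derivative f (at y) v) (at y) w"
proof -
  let ?D = "\<lambda>y. frechet_derivative f (at y) v"
  have near: "dist x (x + s *\<^sub>R v + t *\<^sub>R w) \<le> h * (norm v + norm w)"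
    if "0 \<le> s" "s \<le> h" "0 \<le> t" "t \<le> h" for s t
  proof -
    have "x - (x + s *\<^sub>R v + t *\<^sub>R w) = - (s *\<^sub>R v + t *\<^sub>R w)" by simp
    then have "dist x (x + s *\<^sub>R v + t *\<^sub>R w) = norm (s *\<^sub>R v + t *\<^sub>R w)"
      by (simp only: dist_norm norm_minus_cancel)
    also have "\<dots> \<le> norm (s *\<^sub>R v) + norm (t *\<^sub>R w)" by (rule norm_triangle_ineq)
    also have "\<dots> \<le> h * norm v + h * norm w"
      using that by (intro add_mono) (auto intro: mult_right_mono)
    finally show ?thesis by (simp add: algebra_simps)
  qed
  then have inS: "x + s *\<^sub>R v + t *\<^sub>R w \<in> S" if "0 \<le> s" "s \<le> h" "0 \<le> t" "t \<le> h" for s t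
    using that h(2) S by (meson mem_ball order_le_less_trans subsetD)
  \<comment> \<open>The increment of \<open>g\<close> over \<open>[0, h]\<close> is the second
    difference.\<close>
  define g where "g s = f (x + h *\<^sub>R w + s *\<^sub>R v) - f (x + s *\<^sub>R v)" for s
  have "(g has_real_derivative ?D (x + h *\<^sub>R w + s *\<^sub>R v) - ?D (x + s *\<^sub>R v)) (at s)"
    if "0 \<le> s" "s \<le> h" for s
    unfolding g_def using inS[of s h] inS[of s 0] that h(1)
    by (intro derivative_intros has_real_derivative_along_line diff(1)) (auto simp: add_ac)
  from MVT2[OF h(1) this]
  obtain s where s: "0 < s" "s < h"
    and gs: "g h - g 0 = h * (?D (x + h *\<^sub>R w + s *\<^sub>R v) - ?D (x + s *\<^sub>R v))"
    by auto
  have "((\<lambda>t. ?D (x + s *\<^sub>R v + t *\<^sub>R w)) has_real_derivative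
      frechet_derivative ?D (at (x + s *\<^sub>R v + t *\<^sub>R w)) w) (at t)" if "0 \<le> t" "t \<le> h" for t
    using inS[of s t] that s by (intro has_real_derivative_along_line diff(2)) auto
  from MVT2[OF h(1) this]
  obtain t where t: "0 < t" "t < h"
    and Dt: "?D (x + s *\<^sub>R v + h *\<^sub>R w) - ?D (x + s *\<^sub>R v + 0 *\<^sub>R w)
      = h * frechet_derivative ?D (at (x + s *\<^sub>R v + t *\<^sub>R w)) w"
    by auto
  show thesis
  proof (rule that[OF near[of s t]])
    show "f (x + h *\<^sub>R v + h *\<^sub>R w) - f (x + h *\<^sub>R v) - f (x + h *\<^sub>R w) + f x
      = h\<^sup>2 * frechet_derivative ?D (at (x + s *\<^sub>R v + t *\<^sub>R w)) w"
      using gs Dt by (simp add: g_def power2_eq_square add_ac)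
  qed (use s t in auto)
qed

text \<open>The second difference is symmetric in \<open>v\<close> and \<open>w\<close>, so the two
  mixed derivatives agree at a pair of points arbitrarily close to \<open>x\<close>; their
  continuity carries the equality to \<open>x\<close>.\<close>

lemma Schwarz_mixed_derivatives:
  fixes f :: "'a::real_normed_vector \<Rightarrow> real"
  assumes "open S" "x \<in> S" and C2: "Ck_on 2 f S"
  shows "frechet_derivative (\<lambda>y. frechet_derivative f (at y) v) (at x) w
    = frechet_derivative (\<lambda>y. frechet_derivative f (at y) w) (at x) v"
    (is "?A x = ?B x")
proof -
  have C2': "f differentiable (at y)" "(\<lambda>y. frechet_derivative f (at y) v) differentiable (at y)"
    if "y \<in> S" for y v
    using C2 that by (auto simp: numeral_2_eq_2)
  have cont: "continuous_on S (\<lambda>x. frechet_derivative (\<lambda>y. frechet_derivative f (at y) v) (at x) w)" for v w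
    using C2 by (auto simp: numeral_2_eq_2)
  obtain e where e: "0 < e" "ball x e \<subseteq> S" using assms(1,2) openE by blast
  have "dist (?A x) (?B x) < d" if "0 < d" for d
  proof -
    have "\<exists>r>0. \<forall>y. dist y x < r \<longrightarrow> dist (g y) (g x) < d / 2" if "continuous_on S g" for g :: "'a \<Rightarrow> real"
    proof -
      have "continuous (at x) g" using that assms(1,2) by (simp add: continuous_on_eq_continuous_at)
      then show ?thesis using half_gt_zero[OF \<open>0 < d\<close>] unfolding continuous_at_eps_delta by blast
    qed
    then obtain r1 r2 where r: "0 < r1" "0 < r2"
      "\<And>y. dist y x < r1 \<Longrightarrow> dist (?A y) (?A x) < d / 2"
      "\<And>y. dist y x < r2 \<Longrightarrow> dist (?B y) (?B x) < d / 2"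
      using cont by meson
    define m where "m = min e (min r1 r2)"
    define h where "h = m / (2 * (norm v + norm w + 1))"
    have m: "0 < m" using e r by (simp add: m_def)
    have N: "0 < norm v + norm w + 1" by (simp add: add_nonneg_pos)
    have h: "0 < h" using m N by (simp add: h_def)
    have "h * (norm v + norm w) < h * (2 * (norm v + norm w + 1))"
      using h N by (intro mult_strict_left_mono) auto
    also have "\<dots> = m" using N by (simp add: h_def)
    finally have hm: "h * (norm v + norm w) < m" .
    then have he: "h * (norm v + norm w) < e" "h * (norm w + norm v) < e"
      by (auto simp: m_def add.commute)
    obtain y where y: "dist x y \<le> h * (norm v + norm w)"
      "f (x + h *\<^sub>R v + h *\<^sub>R w) - f (x + h *\<^sub>R v) - f (x + h *\<^sub>R w) + f x = h\<^sup>2 * ?A y"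
      using second_difference_mean_value[OF e(2) C2' h he(1)] by blast
    obtain z where z: "dist x z \<le> h * (norm w + norm v)"
      "f (x + h *\<^sub>R w + h *\<^sub>R v) - f (x + h *\<^sub>R w) - f (x + h *\<^sub>R v) + f x = h\<^sup>2 * ?B z"
      using second_difference_mean_value[OF e(2) C2' h he(2)] by blast
    have "f (x + h *\<^sub>R v + h *\<^sub>R w) - f (x + h *\<^sub>R v) - f (x + h *\<^sub>R w) + f x
        = f (x + h *\<^sub>R w + h *\<^sub>R v) - f (x + h *\<^sub>R w) - f (x + h *\<^sub>R v) + f x"
      by (simp add: algebra_simps)
    then have "h\<^sup>2 * ?A y = h\<^sup>2 * ?B z" unfolding y(2) z(2) .
    then have "?A y = ?B z" using h by simp
    moreover have near: "dist y x < r1" "dist z x < r2"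
      using y(1) z(1) hm by (auto simp: m_def dist_commute add.commute)
    moreover note r(3)[OF near(1)] r(4)[OF near(2)]
    ultimately show ?thesis using dist_triangle_half_r[of "?A y" "?A x" d "?B x"] by simp
  qed
  then show ?thesis by (meson dist_pos_lt less_irrefl)
qed

section \<open>Calculus of partial derivatives\<close>

lemma partial_eqI: "(f has_derivative f') (at x) \<Longrightarrow> partial j f x = f' (axis j 1)"
  by (drule frechet_derivative_at) (simp add: partial_def)

lemma partial_cong_open:
  assumes "open S" "x \<in> S" "\<And>y. y \<in> S \<Longrightarrow> f y = g y"
  shows "partial j f x = partial j g x"
  unfolding partial_def using frechet_derivative_cong_open[OF assms] by simp

lemma Ck_on_partial: "Ck_on (Suc k) f S \<Longrightarrow> Ck_on k (partial j f) S"
  unfolding partial_def[abs_def] by simp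

lemma partial_commute:
  assumes "open S" "x \<in> S" "Ck_on 2 f S"
  shows "partial i (partial j f) x = partial j (partial i f) x"
  unfolding partial_def[abs_def] by (rule Schwarz_mixed_derivatives[OF assms])

lemma partial_add:
  assumes "f differentiable (at x)" "g differentiable (at x)"
  shows "partial j (\<lambda>y. f y + g y) x = partial j f x + partial j g x"
  using assms unfolding partial_def[of j f] partial_def[of j g] frechet_derivative_works
  by (intro partial_eqI) (rule has_derivative_add)

lemma partial_mult:
  assumes "f differentiable (at x)" "g differentiable (at x)"
  shows "partial j (\<lambda>y. f y * g y) x = f x * partial j g x + partial j f x * g x"
  using assms unfolding partial_def[of j f] partial_def[of j g] frechet_derivative_works
  by (intro partial_eqI) (rule has_derivative_mult)

lemma partial_divide_const:
  assumes "f differentiable (at x)"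
  shows "partial j (\<lambda>y. f y / c) x = partial j f x / c"
proof -
  have "((\<lambda>y. f y * inverse c) has_derivative (\<lambda>h. frechet_derivative f (at x) h * inverse c)) (at x)"
    using assms unfolding frechet_derivative_works by (rule has_derivative_mult_left)
  from partial_eqI[OF this] show ?thesis by (simp add: partial_def divide_inverse)
qed

lemma has_derivative_compose_real:
  fixes f :: "'a::real_normed_vector \<Rightarrow> real"
  assumes "(f has_derivative f') (at x)" "(g has_real_derivative d) (at (f x))"
  shows "((\<lambda>y. g (f y)) has_derivative (\<lambda>h. d * f' h)) (at x)"
  using has_derivative_compose[OF assms(1) assms(2)[unfolded has_field_derivative_def]] .

text \<open>Meant for points with E = 0, where the weight is known to be continuous and its cofactor
  vanishes. The error splits into \<open>f y\<close> times the remainder of \<open>g\<close>, and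
  \<open>f y - f x\<close> times \<open>g' (y - x)\<close>; both are of lower order.\<close>

lemma has_derivative_mult_vanishing:
  fixes f g :: "'a::real_normed_vector \<Rightarrow> real"
  assumes f: "isCont f x" and g: "(g has_derivative g') (at x)" and g0: "g x = 0"
  shows "((\<lambda>y. f y * g y) has_derivative (\<lambda>h. f x * g' h)) (at x)"
proof -
  have bl: "bounded_linear g'" using g by (rule has_derivative_bounded_linear)
  then obtain K where K: "\<And>h. norm (g' h) \<le> norm h * K" using bounded_linear.bounded by blast
  have lim: "((\<lambda>y. (1 / norm (y - x)) *\<^sub>R (g y - (g x + g' (y - x)))) \<longlongrightarrow> 0) (at x)"
    using g by (simp add: has_derivative_within)
  have fx: "(f \<longlongrightarrow> f x) (at x)" using f by (simp add: isCont_def)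
  have 1: "((\<lambda>y. f y * ((1 / norm (y - x)) *\<^sub>R (g y - (g x + g' (y - x))))) \<longlongrightarrow> 0) (at x)"
    using tendsto_mult[OF fx lim] by simp
  have 2: "((\<lambda>y. (f y - f x) * ((1 / norm (y - x)) * g' (y - x))) \<longlongrightarrow> 0) (at x)"
  proof (rule Lim_null_comparison)
    show "\<forall>\<^sub>F y in at x. norm ((f y - f x) * ((1 / norm (y - x)) * g' (y - x))) \<le> \<bar>f y - f x\<bar> * K"
      unfolding eventually_at_topological
    proof (intro exI[of _ UNIV] conjI ballI impI)
      fix y assume "y \<noteq> x"
      then have "\<bar>g' (y - x)\<bar> / norm (y - x) \<le> K" using K[of "y - x"] by (simp add: field_simps)
      then have "\<bar>f y - f x\<bar> * (\<bar>g' (y - x)\<bar> / norm (y - x)) \<le> \<bar>f y - f x\<bar> * K"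
        by (intro mult_left_mono) auto
      then show "norm ((f y - f x) * ((1 / norm (y - x)) * g' (y - x))) \<le> \<bar>f y - f x\<bar> * K"
        by (simp add: abs_mult)
    qed simp_all
    have "((\<lambda>y. \<bar>f y - f x\<bar> * K) \<longlongrightarrow> \<bar>f x - f x\<bar> * K) (at x)" by (intro tendsto_intros fx)
    then show "((\<lambda>y. \<bar>f y - f x\<bar> * K) \<longlongrightarrow> 0) (at x)" by simp
  qed
  have "((\<lambda>y. (1 / norm (y - x)) *\<^sub>R (f y * g y - (f x * g x + f x * g' (y - x)))) \<longlongrightarrow> 0) (at x)"
    using tendsto_add[OF 1 2] by (simp add: g0 algebra_simps diff_divide_distrib)
  then show ?thesis
    using bl by (simp add: has_derivative_within bounded_linear_const_mult)
qed

section \<open>The nonlinearity at positive arguments and at zero\<close>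

text \<open>For positive arguments \<open>a\<close> is \<open>b_fun a\<close> divided by the
  identity, and the one-sided derivative is two-sided there.\<close>

lemma C1_halfline_has_real_derivative:
  assumes "C1_halfline (b_fun a)" "0 < t"
  shows "(a has_real_derivative deriv a t) (at t)"
proof -
  have "b_fun a differentiable (at t within {0..})"
    using assms by (auto simp: C1_halfline_def differentiable_on_def)
  moreover have "at t within {0..} = at t"
    using assms(2) by (intro at_within_interior) (simp add: interior_real_atLeast)
  ultimately have "b_fun a differentiable (at t)" by simp
  then obtain d where d: "(b_fun a has_real_derivative d) (at t)"
    using real_differentiable_def by blast
  have "((\<lambda>y. b_fun a y / y) has_real_derivative (d * t - b_fun a t * 1) / (t * t)) (at t)"
    using assms(2) by (intro DERIV_divide[OF d] DERIV_ident) auto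
  then have "(a has_real_derivative (d * t - b_fun a t * 1) / (t * t)) (at t)"
    by (rule has_field_derivative_transform_within_open[of _ _ _ "{0<..}"])
      (use assms(2) in \<open>auto simp: b_fun_def\<close>)
  from this DERIV_imp_deriv[OF this] show ?thesis by simp
qed

text \<open>Since \<open>b_fun a 0 = 0\<close>, the difference quotient of \<open>b_fun a\<close> at
  0 is \<open>a\<close> itself.\<close>

lemma a_ext_continuous_at_zero:
  assumes "C1_halfline (b_fun a)"
  shows "continuous (at 0 within {0..}) (a_ext a)"
proof -
  let ?d = "vector_derivative (b_fun a) (at 0 within {0..})"
  have "b_fun a differentiable (at 0 within {0..})"
    using assms by (auto simp: C1_halfline_def differentiable_on_def)
  then have "(b_fun a has_vector_derivative ?d) (at 0 within {0..})"
    by (simp add: vector_derivative_works)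
  then have "((\<lambda>y. (b_fun a y - b_fun a 0) / (y - 0)) \<longlongrightarrow> ?d) (at 0 within {0..})"
    by (simp add: has_real_derivative_iff_has_vector_derivative[symmetric] has_field_derivative_iff)
  moreover have "\<forall>\<^sub>F y in at 0 within {0..}. (b_fun a y - b_fun a 0) / (y - 0) = a_ext a y"
    unfolding eventually_at_topological
    by (intro exI[of _ UNIV]) (auto simp: b_fun_def a_ext_def)
  ultimately have "(a_ext a \<longlongrightarrow> ?d) (at 0 within {0..})"
    by (rule Lim_transform_eventually)
  then show ?thesis by (simp add: continuous_within a_ext_def)
qed

section \<open>The weighted fields\<close>

lemma partial_sum:
  assumes "\<And>i. i \<in> I \<Longrightarrow> f i differentiable (at x)"
  shows "partial j (\<lambda>y. \<Sum>i\<in>I. f i y) x = (\<Sum>i\<in>I. partial j (f i) x)"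
proof -
  have "((\<lambda>y. \<Sum>i\<in>I. f i y) has_derivative (\<lambda>h. \<Sum>i\<in>I. frechet_derivative (f i) (at x) h)) (at x)"
    using assms by (intro has_derivative_sum) (simp add: frechet_derivative_works)
  from partial_eqI[OF this] show ?thesis by (simp add: partial_def)
qed

lemma Ck_on_SucD: "Ck_on (Suc k) f S \<Longrightarrow> Ck_on k f S"
proof (induction k arbitrary: f)
  case 0
  then show ?case using Ck_on_Suc_continuous_on by (simp only: Ck_on.simps(1))
next
  case (Suc k)
  then show ?case unfolding Ck_on.simps(2)[of "Suc k"] Ck_on.simps(2)[of k f] by blast
qed

lemma Ck_on_Suc_differentiable: "Ck_on (Suc k) f S \<Longrightarrow> x \<in> S \<Longrightarrow> f differentiable (at x)"
  by simp

text \<open>Schwarz's theorem for \<open>partial j f\<close> exchanges the outer two derivatives.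
  For the inner two it is applied to \<open>f\<close> throughout \<open>S\<close>, because that
  equality is then differentiated once more.\<close>

lemma laplacian_partial:
  assumes S: "open S" "x \<in> S" and f: "Ck_on 3 f S"
  shows "laplacian (partial k f) x = partial k (laplacian f) x"
proof -
  have f3: "Ck_on (Suc (Suc (Suc 0))) f S" using f by (simp add: numeral_3_eq_3)
  have f2: "Ck_on 2 f S"
    using Ck_on_SucD[OF f3] by (simp add: numeral_2_eq_2)
  have d2: "Ck_on 2 (partial j f) S" for j
    using Ck_on_partial[OF f3] by (simp add: numeral_2_eq_2)
  have d1: "partial i (partial j f) differentiable (at x)" for i j
    using Ck_on_partial[OF Ck_on_partial[OF f3]] S(2) by (rule Ck_on_Suc_differentiable)
  have "partial k (partial j (partial j f)) x = partial j (partial j (partial k f)) x" for j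
  proof -
    have "partial k (partial j (partial j f)) x = partial j (partial k (partial j f)) x"
      using S d2 by (rule partial_commute)
    also have "\<dots> = partial j (partial j (partial k f)) x"
      using S partial_commute[OF S(1) _ f2] by (intro partial_cong_open) auto
    finally show ?thesis .
  qed
  moreover have "partial k (laplacian f) x = (\<Sum>j\<in>UNIV. partial k (partial j (partial j f)) x)"
    unfolding laplacian_def[abs_def] using d1 by (intro partial_sum) auto
  ultimately show ?thesis by (simp add: laplacian_def)
qed

section \<open>Norms in coordinates and the weighted product rule\<close>

lemma frobenius_norm_2_2: "(norm (M :: real ^ 2 ^ 2))\<^sup>2
    = (M $ 1 $ 1)\<^sup>2 + (M $ 1 $ 2)\<^sup>2 + (M $ 2 $ 1)\<^sup>2 + (M $ 2 $ 2)\<^sup>2"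
  unfolding power2_norm_eq_inner by (simp add: inner_vec_def sum_2 power2_eq_square)

lemma euclidean_norm_2: "(norm (v :: real ^ 2))\<^sup>2 = (v $ 1)\<^sup>2 + (v $ 2)\<^sup>2"
  unfolding power2_norm_eq_inner by (simp add: inner_vec_def sum_2 power2_eq_square)

lemma tensor_norm_2_2_2: "(norm (T :: real ^ 2 ^ 2 ^ 2))\<^sup>2
    = (norm (T $ 1))\<^sup>2 + (norm (T $ 2))\<^sup>2"
  unfolding power2_norm_eq_inner by (simp add: inner_vec_def sum_2)

text \<open>At \<open>\<xi> = 0\<close> both sides vanish whatever \<open>a_ext\<close> is there, so
  the case distinction disappears.\<close>

lemma stress_nth: "stress a \<xi> $ i $ k = a_ext a (norm \<xi>) * \<xi> $ i $ k"
  by (simp add: stress_def a_ext_def)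

lemma partial_sum_squares:
  assumes "e11 differentiable (at x)" "e12 differentiable (at x)" "e22 differentiable (at x)"
  shows "partial j (\<lambda>y. (e11 y)\<^sup>2 + 2 * (e12 y)\<^sup>2 + (e22 y)\<^sup>2) x
    = 2 * (e11 x * partial j e11 x + 2 * (e12 x * partial j e12 x) + e22 x * partial j e22 x)"
    and "(\<lambda>y. (e11 y)\<^sup>2 + 2 * (e12 y)\<^sup>2 + (e22 y)\<^sup>2) differentiable (at x)"
proof -
  let ?Q = "\<lambda>y. (e11 y)\<^sup>2 + 2 * (e12 y)\<^sup>2 + (e22 y)\<^sup>2"
  note d = assms[unfolded frechet_derivative_works]
  have D: "(?Q has_derivative (\<lambda>h. 2 * (e11 x * frechet_derivative e11 (at x) h
      + 2 * (e12 x * frechet_derivative e12 (at x) h) + e22 x * frechet_derivative e22 (at x) h))) (at x)"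
    by (rule derivative_eq_intros d refl)+ (simp add: algebra_simps)
  show "partial j ?Q x = 2 * (e11 x * partial j e11 x + 2 * (e12 x * partial j e12 x) + e22 x * partial j e22 x)"
    using partial_eqI[OF D, of j] by (simp add: partial_def)
  show "?Q differentiable (at x)" using D by (auto simp: differentiable_def)
qed

text \<open>Where the matrix field vanishes, \<open>t = 0\<close> and \<open>g x / r x = 0\<close>, so the same formulas cover
  the degenerate points; the direction \<open>n\<close> is then an arbitrary unit matrix.\<close>

lemma weight_product_rule:
  fixes e11 e12 e22 :: "real ^ 'n \<Rightarrow> real"
  assumes C1: "C1_halfline (b_fun a)" and pos: "\<And>t. 0 < t \<Longrightarrow> 0 < a t"
    and index: "\<And>t. 0 < t \<Longrightarrow> lo \<le> t * deriv a t / a t \<and> t * deriv a t / a t \<le> hi"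
    and lohi: "lo \<le> 0" "0 \<le> hi"
    and d: "e11 differentiable (at x)" "e12 differentiable (at x)" "e22 differentiable (at x)"
    and r: "\<And>y. 0 \<le> r y" "\<And>y. (r y)\<^sup>2 = (e11 y)\<^sup>2 + 2 * (e12 y)\<^sup>2 + (e22 y)\<^sup>2"
  obtains t n11 n12 n22 where "lo \<le> t" "t \<le> hi" "n11\<^sup>2 + 2 * n12\<^sup>2 + n22\<^sup>2 = 1" "r x = 0 \<Longrightarrow> t = 0"
    "e11 x = r x * n11" "e12 x = r x * n12" "e22 x = r x * n22"
    "\<And>g j. g differentiable (at x) \<Longrightarrow> (r x = 0 \<Longrightarrow> g x = 0) \<Longrightarrow>
      partial j (\<lambda>y. a_ext a (r y) * g y) x = a_ext a (r x) * (partial j g x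
        + t * (n11 * partial j e11 x + 2 * n12 * partial j e12 x + n22 * partial j e22 x) * (g x / r x))"
    "\<And>g j. g differentiable (at x) \<Longrightarrow> (r x = 0 \<Longrightarrow> g x = 0) \<Longrightarrow>
      partial j (\<lambda>y. (a_ext a (r y))\<^sup>2 * g y) x = (a_ext a (r x))\<^sup>2 * (partial j g x
        + 2 * t * (n11 * partial j e11 x + 2 * n12 * partial j e12 x + n22 * partial j e22 x) * (g x / r x))"
proof -
  define Q where "Q y = (e11 y)\<^sup>2 + 2 * (e12 y)\<^sup>2 + (e22 y)\<^sup>2" for y
  have rQ: "r = (\<lambda>y. sqrt (Q y))"
    using r by (auto simp: Q_def real_sqrt_unique[symmetric])
  have Qdiff: "Q differentiable (at x)"
    and Qpartial: "partial j Q x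
      = 2 * (e11 x * partial j e11 x + 2 * (e12 x * partial j e12 x) + e22 x * partial j e22 x)" for j
    unfolding Q_def[abs_def] by (rule partial_sum_squares d)+
  show thesis
  proof (cases "r x = 0")
    case True
    then have "(e11 x)\<^sup>2 + 2 * (e12 x)\<^sup>2 + (e22 x)\<^sup>2 = 0" using r(2)[of x] by simp
    then have "(e11 x)\<^sup>2 = 0" "(e12 x)\<^sup>2 = 0" "(e22 x)\<^sup>2 = 0"
      using zero_le_power2[of "e11 x"] zero_le_power2[of "e12 x"] zero_le_power2[of "e22 x"]
      by linarith+
    then have e0: "e11 x = 0" "e12 x = 0" "e22 x = 0" by simp_all
    have "isCont r x" unfolding rQ
      using Qdiff by (intro continuous_intros differentiable_imp_continuous_within)
    then have "(r \<longlongrightarrow> r x) (at x)" by (simp add: isCont_def)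
    \<comment> \<open>\<open>r\<close> tends to 0 through nonnegative values, so one-sided
      continuity of \<open>a_ext a\<close> at 0 suffices.\<close>
    then have "((\<lambda>y. a_ext a (r y)) \<longlongrightarrow> a_ext a (r x)) (at x)"
      unfolding True
      by (rule continuous_within_tendsto_compose'[OF a_ext_continuous_at_zero[OF C1], rotated])
        (use r(1) in auto)
    then have cont: "isCont (\<lambda>y. a_ext a (r y)) x" by (simp add: isCont_def)
    then have cont2: "isCont (\<lambda>y. (a_ext a (r y))\<^sup>2) x" by (intro continuous_intros)
    have rule: "partial j (\<lambda>y. f y * g y) x = f x * partial j g x"
      if "isCont f x" "g differentiable (at x)" "g x = 0" for f g :: "real ^ 'n \<Rightarrow> real" and j
      using partial_eqI[OF has_derivative_mult_vanishing[OF that(1)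
          that(2)[unfolded frechet_derivative_works] that(3)]]
      by (simp add: partial_def)
    \<comment> \<open>The witnesses are \<open>t = 0\<close>, admissible because
      \<open>lo <= 0 <= hi\<close>, and the unit matrix with \<open>n11 = 1\<close> and other
      entries 0.\<close>
    show thesis
      by (rule that[of 0 1 0 0]) (use True e0 lohi rule[OF cont] rule[OF cont2] in simp_all)
  next
    case False
    then have rpos: "0 < r x" using r(1)[of x] by simp
    then have Qpos: "0 < Q x" by (simp add: rQ)
    define t where "t = r x * deriv a (r x) / a (r x)"
    define n11 n12 n22 where "n11 = e11 x / r x" and "n12 = e12 x / r x" and "n22 = e22 x / r x"
    have apos: "0 < a (r x)" "a_ext a (r x) = a (r x)" using pos rpos by (simp_all add: a_ext_def)
    have n: "e11 x = r x * n11" "e12 x = r x * n12" "e22 x = r x * n22"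
      using rpos by (simp_all add: n11_def n12_def n22_def)
    have "(r x)\<^sup>2 * (n11\<^sup>2 + 2 * n12\<^sup>2 + n22\<^sup>2) = (r x)\<^sup>2 * 1"
      using r(2)[of x] unfolding n by (simp add: power_mult_distrib algebra_simps)
    then have unit: "n11\<^sup>2 + 2 * n12\<^sup>2 + n22\<^sup>2 = 1" using rpos by simp
    \<comment> \<open>The weight is differentiated as a function of the squared norm
      \<open>Q\<close>, which is differentiable at \<open>x\<close>; the square root is
      differentiable at \<open>Q x > 0\<close>.\<close>
    have "((\<lambda>q. a (sqrt q)) has_real_derivative deriv a (r x) * (inverse (r x) / 2)) (at (Q x))"
      using DERIV_chain2[OF _ DERIV_real_sqrt[OF Qpos], of a] C1_halfline_has_real_derivative[OF C1 rpos]
      by (simp add: rQ)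
    then have "((\<lambda>q. a_ext a (sqrt q)) has_real_derivative deriv a (r x) * (inverse (r x) / 2)) (at (Q x))"
      by (rule has_field_derivative_transform_within_open[of _ _ _ "{0<..}"])
        (use Qpos in \<open>auto simp: a_ext_def\<close>)
    from has_derivative_compose_real[OF Qdiff[unfolded frechet_derivative_works] this]
    have D: "((\<lambda>y. a_ext a (r y)) has_derivative
        (\<lambda>h. deriv a (r x) * (inverse (r x) / 2) * frechet_derivative Q (at x) h)) (at x)"
      by (simp add: rQ)
    then have Pdiff: "(\<lambda>y. a_ext a (r y)) differentiable (at x)" by (auto simp: differentiable_def)
    let ?w = "\<lambda>j. n11 * partial j e11 x + 2 * n12 * partial j e12 x + n22 * partial j e22 x"
    have Ppartial: "partial j (\<lambda>y. a_ext a (r y)) x = a (r x) * t * ?w j / r x" for j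
    proof -
      have "partial j Q x = 2 * r x * ?w j" unfolding Qpartial n by (simp add: algebra_simps)
      then show ?thesis
        using partial_eqI[OF D, of j] rpos apos by (simp add: partial_def t_def)
    qed
    show thesis
    proof (rule that[of t n11 n12 n22])
      fix g :: "real ^ 'n \<Rightarrow> real" and j
      assume g: "g differentiable (at x)"
      show "partial j (\<lambda>y. a_ext a (r y) * g y) x
        = a_ext a (r x) * (partial j g x + t * ?w j * (g x / r x))"
        unfolding partial_mult[OF Pdiff g] Ppartial apos
        by (simp add: algebra_simps add_divide_distrib)
      \<comment> \<open>The squared weight is two successive applications of the product rule,
        whence the factor 2.\<close>
      have "partial j (\<lambda>y. a_ext a (r y) * (a_ext a (r y) * g y)) x
        = (a_ext a (r x))\<^sup>2 * (partial j g x + 2 * t * ?w j * (g x / r x))"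
        unfolding partial_mult[OF Pdiff differentiable_mult[OF Pdiff g]] partial_mult[OF Pdiff g]
          Ppartial apos
        by (simp add: algebra_simps add_divide_distrib power2_eq_square)
      then show "partial j (\<lambda>y. (a_ext a (r y))\<^sup>2 * g y) x
        = (a_ext a (r x))\<^sup>2 * (partial j g x + 2 * t * ?w j * (g x / r x))"
        by (simp add: power2_eq_square mult.assoc)
    qed (use index[OF rpos] unit n rpos in \<open>auto simp: t_def\<close>)
  qed
qed


text \<open>\<open>V l m k\<close> is component \<open>k\<close> of the unweighted field, with
  \<open>l\<close> and \<open>m\<close> the entries of column \<open>k\<close> of E. Second
  derivatives of E enter its divergence as E : grad L - E : (Laplacian of E). By \<open>lap\<close>
  the Laplacian of E is the symmetric gradient of L, so they cancel.\<close>

lemma divergence_identity: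
  fixes e11 e12 e22 L1 L2 :: "real ^ 2 \<Rightarrow> real"
  assumes d: "e11 differentiable (at x)" "e12 differentiable (at x)" "e22 differentiable (at x)"
      "L1 differentiable (at x)" "L2 differentiable (at x)"
      "\<And>k. partial k e11 differentiable (at x)" "\<And>k. partial k e12 differentiable (at x)"
      "\<And>k. partial k e22 differentiable (at x)"
    and lap: "laplacian e11 x = partial 1 L1 x" "laplacian e22 x = partial 2 L2 x"
      "2 * laplacian e12 x = partial 2 L1 x + partial 1 L2 x"
  defines "V \<equiv> \<lambda>l m k y. L1 y * l y + L2 y * m y
      - (e11 y * partial k e11 y + 2 * (e12 y * partial k e12 y) + e22 y * partial k e22 y)"
  shows "V e11 e12 1 differentiable (at x)" "V e12 e22 2 differentiable (at x)"
    "partial 1 (V e11 e12 1) x + partial 2 (V e12 e22 2) x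
      = (partial 1 e11 x + partial 2 e12 x) * L1 x + (partial 1 e12 x + partial 2 e22 x) * L2 x
        - ((partial 1 e11 x)\<^sup>2 + (partial 2 e11 x)\<^sup>2 + (partial 1 e22 x)\<^sup>2 + (partial 2 e22 x)\<^sup>2
          + 2 * (partial 1 e12 x)\<^sup>2 + 2 * (partial 2 e12 x)\<^sup>2)"
proof -
  note d = d[unfolded frechet_derivative_works]
  have D: "(V l m k has_derivative (\<lambda>h. L1 x * frechet_derivative l (at x) h
        + frechet_derivative L1 (at x) h * l x
        + (L2 x * frechet_derivative m (at x) h + frechet_derivative L2 (at x) h * m x)
        - (e11 x * frechet_derivative (partial k e11) (at x) h
            + frechet_derivative e11 (at x) h * partial k e11 x
          + 2 * (e12 x * frechet_derivative (partial k e12) (at x) h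
            + frechet_derivative e12 (at x) h * partial k e12 x)
          + (e22 x * frechet_derivative (partial k e22) (at x) h
            + frechet_derivative e22 (at x) h * partial k e22 x)))) (at x)"
    if "l differentiable (at x)" "m differentiable (at x)" for l m k
    unfolding V_def
    by (rule derivative_eq_intros d that[unfolded frechet_derivative_works] refl)+
  show "V e11 e12 1 differentiable (at x)" "V e12 e22 2 differentiable (at x)"
    using D[OF assms(1,2)] D[OF assms(2,3)] unfolding differentiable_def by blast+
  have L: "partial 1 L1 x = partial 1 (partial 1 e11) x + partial 2 (partial 2 e11) x"
    "partial 2 L2 x = partial 1 (partial 1 e22) x + partial 2 (partial 2 e22) x"
    "partial 2 L1 x = 2 * (partial 1 (partial 1 e12) x + partial 2 (partial 2 e12) x) - partial 1 L2 x"
    using lap by (simp_all add: laplacian_def sum_2)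
  show "partial 1 (V e11 e12 1) x + partial 2 (V e12 e22 2) x
      = (partial 1 e11 x + partial 2 e12 x) * L1 x + (partial 1 e12 x + partial 2 e22 x) * L2 x
        - ((partial 1 e11 x)\<^sup>2 + (partial 2 e11 x)\<^sup>2 + (partial 1 e22 x)\<^sup>2 + (partial 2 e22 x)\<^sup>2
          + 2 * (partial 1 e12 x)\<^sup>2 + 2 * (partial 2 e12 x)\<^sup>2)"
    unfolding partial_eqI[OF D[OF assms(1,2)]] partial_eqI[OF D[OF assms(2,3)]]
      partial_def[symmetric]
    unfolding L by (simp add: power2_eq_square algebra_simps)
qed

section \<open>From the pointwise inequality to the differential inequality\<close>

text \<open>The constants are chosen after \<open>i\<close> and \<open>s\<close> but before the
  domain, \<open>a\<close> and \<open>u\<close>; this expresses that they depend on the two indices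
  alone.\<close>

theorem lemma3p7:
  fixes i s :: ereal
  assumes "ereal (- (5 / (2 * (4 + sqrt 6)))) < i" and "i \<le> s" and "s < \<infinity>"
  shows "\<exists>c1 c2 :: real. c1 > 0 \<and> c2 > 0 \<and>
    (\<forall>(\<Omega> :: (real ^ 2) set) (a :: real \<Rightarrow> real) (u :: real ^ 2 \<Rightarrow> real ^ 2).
       open \<Omega> \<longrightarrow> (\<forall>t>0. a t > 0) \<longrightarrow> C1_halfline (b_fun a) \<longrightarrow>
       lower_index a = i \<longrightarrow> upper_index a = s \<longrightarrow> Ck_on 3 u \<Omega> \<longrightarrow>
       (\<forall>x\<in>\<Omega>.
          (norm (mat_div (\<lambda>y. stress a (sym_grad u y)) x))\<^sup>2
          \<ge> c1 * (a_ext a (norm (sym_grad u x)))\<^sup>2 * (norm (mat_grad (sym_grad u) x))\<^sup>2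
            + c2 * vec_div
                (\<lambda>y. (a_ext a (norm (sym_grad u y)))\<^sup>2 *\<^sub>R
                   (vec_laplacian u y v* sym_grad u y
                    - (1/2) *\<^sub>R grad (\<lambda>z. (norm (sym_grad u z))\<^sup>2) y)) x))"
proof -
  define S where "S = max 1 (real_of_ereal s)"
  have S: "1 \<le> S" "s \<le> ereal S"
    using assms by (cases s; simp add: S_def)+
  have "sqrt ((9/4)\<^sup>2) \<le> sqrt 6" by (intro real_sqrt_le_mono) (simp add: power2_eq_square)
  then have "9/4 \<le> sqrt 6" by simp
  \<comment> \<open>With 9/4 in place of the root the denominator is 25/2, and 5 divided by 25/2 is
    2/5.\<close>
  then have "- (2/5) \<le> - (5 / (2 * (4 + sqrt 6)))" by (simp add: field_simps)
  then have i: "ereal (- (2/5)) \<le> i"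
    using assms(1) by (meson ereal_less_eq(3) order_trans less_imp_le)
  obtain k1 k2 where k: "0 < k1" "0 < k2" and ineq:
    "\<And>t n11 n12 n22 x1 x2 y1 y2 z1 z2 w1 w2 L1 L2.
    - (2/5) \<le> t \<Longrightarrow> t \<le> S \<Longrightarrow> n11\<^sup>2 + 2 * n12\<^sup>2 + n22\<^sup>2 = 1 \<Longrightarrow>
    w1 = n11 * x1 + 2 * n12 * z1 + n22 * y1 \<Longrightarrow> w2 = n11 * x2 + 2 * n12 * z2 + n22 * y2 \<Longrightarrow>
    L1 = x1 + 2 * z2 - y1 \<Longrightarrow> L2 = y2 + 2 * z1 - x2 \<Longrightarrow>
    k1 * (x1\<^sup>2 + x2\<^sup>2 + y1\<^sup>2 + y2\<^sup>2 + 2 * z1\<^sup>2 + 2 * z2\<^sup>2)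
      + k2 * (2 * t * (w1 * (n11 * L1 + n12 * L2 - w1) + w2 * (n12 * L1 + n22 * L2 - w2))
         + ((x1 + z2) * L1 + (z1 + y2) * L2)
         - (x1\<^sup>2 + x2\<^sup>2 + y1\<^sup>2 + y2\<^sup>2 + 2 * z1\<^sup>2 + 2 * z2\<^sup>2))
    \<le> (x1 + z2 + t * (n11 * w1 + n12 * w2))\<^sup>2 + (z1 + y2 + t * (n12 * w1 + n22 * w2))\<^sup>2"
    using pointwise_inequality[OF S(1)] by blast
  show ?thesis
  proof (rule exI[of _ k1], rule exI[of _ k2], intro conjI k allI impI ballI)
    fix \<Omega> :: "(real ^ 2) set" and a :: "real \<Rightarrow> real" and u :: "real ^ 2 \<Rightarrow> real ^ 2" and x
    assume \<Omega>: "open \<Omega>" and apos: "\<forall>t>0. 0 < a t" and C1: "C1_halfline (b_fun a)"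
      and idx: "lower_index a = i" "upper_index a = s" and u: "Ck_on 3 u \<Omega>" and x: "x \<in> \<Omega>"
    have index: "- (2/5) \<le> t * deriv a t / a t \<and> t * deriv a t / a t \<le> S" if "0 < t" for t
    proof -
      have "i \<le> ereal (t * deriv a t / a t)" "ereal (t * deriv a t / a t) \<le> s"
        unfolding idx[symmetric] lower_index_def upper_index_def
        using that by (auto intro: INF_lower SUP_upper)
      then show ?thesis using i S(2) by (meson ereal_less_eq(3) order_trans)
    qed
    \<comment> \<open>\<open>U\<close>, \<open>e\<close> and \<open>L\<close> are the components of
      u, of E and of the Laplacian of u.\<close>
    define U where "U j = (\<lambda>y. u y $ j)" for j
    define e where "e j k = (\<lambda>y. (partial k (U j) y + partial j (U k) y) / 2)" for j k
    define L where "L j = laplacian (U j)" for j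
    have U3: "Ck_on (Suc (Suc (Suc 0))) (U j) \<Omega>" for j
      using Ck_on_component[OF u \<Omega>, of j] by (simp only: U_def numeral_3_eq_3)
    then have U3': "Ck_on 3 (U j) \<Omega>" for j by (simp only: numeral_3_eq_3)
    have U2: "Ck_on 2 (U j) \<Omega>" for j
      using Ck_on_SucD[OF U3] by (simp only: numeral_2_eq_2)
    note dU = Ck_on_partial[OF U3]
    note ddU = Ck_on_partial[OF dU]
    have dU_diff: "partial k (U j) differentiable (at y)" if "y \<in> \<Omega>" for j k y
      using dU that by (rule Ck_on_Suc_differentiable)
    have ddU_diff: "partial l (partial k (U j)) differentiable (at y)" if "y \<in> \<Omega>" for j k l y
      using ddU that by (rule Ck_on_Suc_differentiable)
    have e_diff: "e j k differentiable (at y)" if "y \<in> \<Omega>" for j k y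
      unfolding e_def using dU_diff[OF that] by (intro derivative_intros) auto
    have e_partial: "partial l (e j k) y
        = (partial l (partial k (U j)) y + partial l (partial j (U k)) y) / 2" if "y \<in> \<Omega>" for j k l y
      unfolding e_def using dU_diff[OF that]
      by (simp add: partial_divide_const partial_add differentiable_add)
    have de_diff: "partial l (e j k) differentiable (at x)" for j k l
    proof (rule differentiable_cong_open[OF _ \<Omega> x])
      show "(\<lambda>y. (partial l (partial k (U j)) y + partial l (partial j (U k)) y) / 2) differentiable (at x)"
        using ddU_diff[OF x] by (intro derivative_intros) auto
    qed (simp add: e_partial)
    have L_diff: "L j differentiable (at x)" for j
      unfolding L_def laplacian_def[abs_def] using ddU_diff[OF x] by (intro derivative_intros) auto
    have dde: "partial m (partial l (e j k)) x = (partial m (partial l (partial k (U j))) x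
        + partial m (partial l (partial j (U k))) x) / 2" for j k l m
    proof -
      have "partial m (partial l (e j k)) x
          = partial m (\<lambda>y. (partial l (partial k (U j)) y + partial l (partial j (U k)) y) / 2) x"
        using e_partial by (intro partial_cong_open[OF \<Omega> x]) auto
      also have "\<dots> = (partial m (partial l (partial k (U j))) x
          + partial m (partial l (partial j (U k))) x) / 2"
        using ddU_diff[OF x] by (simp add: partial_divide_const partial_add differentiable_add)
      finally show ?thesis .
    qed
    have lap_e: "laplacian (e j k) x = (partial k (L j) x + partial j (L k) x) / 2" for j k
    proof -
      have "laplacian (e j k) x = (laplacian (partial k (U j)) x + laplacian (partial j (U k)) x) / 2"
        by (simp add: laplacian_def dde sum.distrib sum_divide_distrib add_divide_distrib)
      then show ?thesis by (simp add: laplacian_partial[OF \<Omega> x U3'] L_def)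
    qed
    have e_sym: "e 2 1 = e 1 2" by (simp add: e_def add.commute)
    have sg: "sym_grad u y $ j $ k = e j k y" for y j k
      by (simp add: sym_grad_def vec_grad_def grad_def transpose_def e_def U_def)
    define r where "r y = norm (sym_grad u y)" for y
    have r2: "(r y)\<^sup>2 = (e 1 1 y)\<^sup>2 + 2 * (e 1 2 y)\<^sup>2 + (e 2 2 y)\<^sup>2" for y
      unfolding r_def frobenius_norm_2_2 sg by (simp add: e_sym)
    have r0: "0 \<le> r y" for y by (simp add: r_def)
    obtain t n11 n12 n22 where t: "- (2/5) \<le> t" "t \<le> S" and unit: "n11\<^sup>2 + 2 * n12\<^sup>2 + n22\<^sup>2 = 1"
      and t0: "r x = 0 \<Longrightarrow> t = 0"
      and n: "e 1 1 x = r x * n11" "e 1 2 x = r x * n12" "e 2 2 x = r x * n22"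
      and P1: "\<And>g j. g differentiable (at x) \<Longrightarrow> (r x = 0 \<Longrightarrow> g x = 0) \<Longrightarrow>
        partial j (\<lambda>y. a_ext a (r y) * g y) x = a_ext a (r x) * (partial j g x
        + t * (n11 * partial j (e 1 1) x + 2 * n12 * partial j (e 1 2) x + n22 * partial j (e 2 2) x)
          * (g x / r x))"
      and P2: "\<And>g j. g differentiable (at x) \<Longrightarrow> (r x = 0 \<Longrightarrow> g x = 0) \<Longrightarrow>
        partial j (\<lambda>y. (a_ext a (r y))\<^sup>2 * g y) x = (a_ext a (r x))\<^sup>2 * (partial j g x
        + 2 * t * (n11 * partial j (e 1 1) x + 2 * n12 * partial j (e 1 2) x + n22 * partial j (e 2 2) x)
          * (g x / r x))"
      by (rule weight_product_rule[of a "- (2/5)" S "e 1 1" x "e 1 2" "e 2 2" r])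
        (use C1 apos index S(1) e_diff[OF x] r0 r2 in auto)
    define x1 x2 y1 y2 z1 z2 where "x1 = partial 1 (e 1 1) x" and "x2 = partial 2 (e 1 1) x"
      and "y1 = partial 1 (e 2 2) x" and "y2 = partial 2 (e 2 2) x"
      and "z1 = partial 1 (e 1 2) x" and "z2 = partial 2 (e 1 2) x"
    note defs = this
    define w1 w2 where "w1 = n11 * x1 + 2 * n12 * z1 + n22 * y1"
      and "w2 = n11 * x2 + 2 * n12 * z2 + n22 * y2"
    define P where "P = a_ext a (r x)"
    \<comment> \<open>Where \<open>r x = 0\<close> the quotient is 0 by convention, but there
      \<open>t = 0\<close> as well.\<close>
    have cancel: "t * w * (r x * b / r x) = t * w * b" for w b
      using t0 by (cases "r x = 0") auto
    \<comment> \<open>All second derivatives of u, in particular its Laplacian, are combinations of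
      first derivatives of E.\<close>
    have L: "L 1 x = x1 + 2 * z2 - y1" "L 2 x = y2 + 2 * z1 - x2"
      unfolding defs e_partial[OF x] L_def laplacian_def sum_2
      using partial_commute[OF \<Omega> x U2, of 1 2] by (simp_all add: field_simps)
    have lhs: "(norm (mat_div (\<lambda>y. stress a (sym_grad u y)) x))\<^sup>2
      = P\<^sup>2 * ((x1 + z2 + t * (n11 * w1 + n12 * w2))\<^sup>2 + (z1 + y2 + t * (n12 * w1 + n22 * w2))\<^sup>2)"
    proof -
      have der: "partial l (\<lambda>y. a_ext a (r y) * e j k y) x = P * (partial l (e j k) x + t *
          (n11 * partial l (e 1 1) x + 2 * n12 * partial l (e 1 2) x + n22 * partial l (e 2 2) x) * m)"
        if "e j k x = r x * m" for j k l m
        using P1[of "e j k" l] e_diff[OF x] that t0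
        by (cases "r x = 0") (simp_all add: P_def)
      have "mat_div (\<lambda>y. stress a (sym_grad u y)) x $ 1 = P * (x1 + z2 + t * (n11 * w1 + n12 * w2))"
        "mat_div (\<lambda>y. stress a (sym_grad u y)) x $ 2 = P * (z1 + y2 + t * (n12 * w1 + n22 * w2))"
        by (simp_all add: mat_div_def vec_div_def stress_nth sg r_def[symmetric] sum_2 e_sym
            der[OF n(1)] der[OF n(2)] der[OF n(3)] defs[symmetric] w1_def[symmetric] w2_def[symmetric])
          (simp_all add: algebra_simps)
      then show ?thesis
        unfolding euclidean_norm_2 by (simp only: power_mult_distrib distrib_left[of "P\<^sup>2"])
    qed
    have grad_norm: "(norm (mat_grad (sym_grad u) x))\<^sup>2
        = x1\<^sup>2 + x2\<^sup>2 + y1\<^sup>2 + y2\<^sup>2 + 2 * z1\<^sup>2 + 2 * z2\<^sup>2"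
      unfolding tensor_norm_2_2_2 frobenius_norm_2_2
      by (simp add: mat_grad_def vec_grad_def grad_def sg e_sym defs)
    define V where "V = (\<lambda>l m k y. L 1 y * l y + L 2 y * m y
      - (e 1 1 y * partial k (e 1 1) y + 2 * (e 1 2 y * partial k (e 1 2) y)
        + e 2 2 y * partial k (e 2 2) y))"
    have V: "V (e 1 1) (e 1 2) 1 differentiable (at x)" "V (e 1 2) (e 2 2) 2 differentiable (at x)"
      "partial 1 (V (e 1 1) (e 1 2) 1) x + partial 2 (V (e 1 2) (e 2 2) 2) x
        = (x1 + z2) * L 1 x + (z1 + y2) * L 2 x
          - (x1\<^sup>2 + x2\<^sup>2 + y1\<^sup>2 + y2\<^sup>2 + 2 * z1\<^sup>2 + 2 * z2\<^sup>2)"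
      unfolding V_def defs
      by (rule divergence_identity; simp add: e_diff[OF x] de_diff L_diff lap_e)+
    \<comment> \<open>The factor \<open>r x\<close> makes \<open>V\<close> vanish where E does, as
      \<open>P2\<close> requires; its cofactor is what \<open>V / r\<close> contributes to the
      product rule.\<close>
    have Vx: "V (e 1 1) (e 1 2) 1 x = r x * (n11 * L 1 x + n12 * L 2 x - w1)"
      "V (e 1 2) (e 2 2) 2 x = r x * (n12 * L 1 x + n22 * L 2 x - w2)"
      unfolding V_def n defs[symmetric] w1_def w2_def by (simp_all add: algebra_simps)
    have rhs: "vec_div (\<lambda>y. (a_ext a (norm (sym_grad u y)))\<^sup>2 *\<^sub>R
          (vec_laplacian u y v* sym_grad u y
            - (1/2) *\<^sub>R grad (\<lambda>z. (norm (sym_grad u z))\<^sup>2) y)) x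
      = P\<^sup>2 * (2 * t * (w1 * (n11 * L 1 x + n12 * L 2 x - w1) + w2 * (n12 * L 1 x + n22 * L 2 x - w2))
         + ((x1 + z2) * L 1 x + (z1 + y2) * L 2 x)
         - (x1\<^sup>2 + x2\<^sup>2 + y1\<^sup>2 + y2\<^sup>2 + 2 * z1\<^sup>2 + 2 * z2\<^sup>2))"
    proof -
      let ?F = "\<lambda>y. (a_ext a (norm (sym_grad u y)))\<^sup>2 *\<^sub>R
          (vec_laplacian u y v* sym_grad u y
            - (1/2) *\<^sub>R grad (\<lambda>z. (norm (sym_grad u z))\<^sup>2) y)"
      \<comment> \<open>The factor 1/2 cancels the 2 from differentiating |E|^2. The equality holds
        on the open set \<open>\<Omega>\<close>, which is enough to differentiate it at
        \<open>x\<close>.\<close>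
      have "?F y $ k = (a_ext a (r y))\<^sup>2 * V (e 1 k) (e 2 k) k y" if "y \<in> \<Omega>" for y k
        using partial_sum_squares(1)[OF e_diff[OF that] e_diff[OF that] e_diff[OF that], of k 1 1 1 2 2 2]
        by (simp add: V_def r_def[symmetric] r2 vector_matrix_mult_def grad_def sum_2 sg
            vec_laplacian_def L_def U_def mult.commute add_divide_distrib)
      then have "partial k (\<lambda>y. ?F y $ k) x
          = partial k (\<lambda>y. (a_ext a (r y))\<^sup>2 * V (e 1 k) (e 2 k) k y) x" for k
        by (intro partial_cong_open[OF \<Omega> x])
      then have "vec_div ?F x
          = partial 1 (\<lambda>y. (a_ext a (r y))\<^sup>2 * V (e 1 1) (e 1 2) 1 y) x
            + partial 2 (\<lambda>y. (a_ext a (r y))\<^sup>2 * V (e 1 2) (e 2 2) 2 y) x"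
        unfolding vec_div_def sum_2 by (simp only: e_sym)
      also have "\<dots> = P\<^sup>2 * (partial 1 (V (e 1 1) (e 1 2) 1) x
            + 2 * t * w1 * (n11 * L 1 x + n12 * L 2 x - w1)
          + (partial 2 (V (e 1 2) (e 2 2) 2) x
            + 2 * t * w2 * (n12 * L 1 x + n22 * L 2 x - w2)))"
      proof -
        have c: "2 * t * w * (r x * b / r x) = 2 * t * w * b" for w b
          using cancel[of w b] by (simp only: mult.assoc)
        show ?thesis
          using P2[OF V(1), of 1] P2[OF V(2), of 2]
          unfolding Vx defs[symmetric] w1_def[symmetric] w2_def[symmetric] P_def[symmetric] c
          by (simp add: distrib_left)
      qed
      also have "\<dots> = P\<^sup>2 * (2 * t * (w1 * (n11 * L 1 x + n12 * L 2 x - w1)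
            + w2 * (n12 * L 1 x + n22 * L 2 x - w2))
          + (partial 1 (V (e 1 1) (e 1 2) 1) x + partial 2 (V (e 1 2) (e 2 2) 2) x))"
        by (simp add: algebra_simps)
      finally show ?thesis unfolding V(3) by simp
    qed
    \<comment> \<open>Both sides carry the same nonnegative factor \<open>P^2\<close>, so the
      inequality for the quadratic forms is multiplied by it.\<close>
    have "P\<^sup>2 * (k1 * (x1\<^sup>2 + x2\<^sup>2 + y1\<^sup>2 + y2\<^sup>2 + 2 * z1\<^sup>2 + 2 * z2\<^sup>2)
      + k2 * (2 * t * (w1 * (n11 * L 1 x + n12 * L 2 x - w1) + w2 * (n12 * L 1 x + n22 * L 2 x - w2))
         + ((x1 + z2) * L 1 x + (z1 + y2) * L 2 x)
         - (x1\<^sup>2 + x2\<^sup>2 + y1\<^sup>2 + y2\<^sup>2 + 2 * z1\<^sup>2 + 2 * z2\<^sup>2)))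
      \<le> P\<^sup>2 * ((x1 + z2 + t * (n11 * w1 + n12 * w2))\<^sup>2 + (z1 + y2 + t * (n12 * w1 + n22 * w2))\<^sup>2)"
      by (intro mult_left_mono ineq t unit w1_def w2_def L) simp
    then show "k1 * (a_ext a (norm (sym_grad u x)))\<^sup>2 * (norm (mat_grad (sym_grad u) x))\<^sup>2
            + k2 * vec_div
                (\<lambda>y. (a_ext a (norm (sym_grad u y)))\<^sup>2 *\<^sub>R
                   (vec_laplacian u y v* sym_grad u y
                    - (1/2) *\<^sub>R grad (\<lambda>z. (norm (sym_grad u z))\<^sup>2) y)) x
          \<le> (norm (mat_div (\<lambda>y. stress a (sym_grad u y)) x))\<^sup>2"
      unfolding lhs rhs grad_norm unfolding r_def[symmetric] P_def[symmetric] distrib_left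
      by (simp only: mult.assoc mult.left_commute)
  qed
qed

end
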